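(* Let $J_\infty:\mathcal K\to\mathbb R$ be the state-feedback $\mathcal H_\infty$ cost and let $(\mathfrak L_{\mathrm{lft}},\mathfrak F_{\mathrm{cvx}},\Phi)$ be its convex lifting, all as defined in the context. Then for each $\Delta>0$: 1. The set $\{(K,\gamma,P)\in\mathfrak L_{\mathrm{lft}}:\gamma\le\Delta\}$ is compact. 2. There exists some $G_\Delta>0$ such that $J_\infty$ is $G_\Delta$-Lipschitz continuous on the sublevel set $\mathcal S(\Delta)=\{K\in\mathcal K: J_\infty(K)\le\Delta\}$, i.e., $|J_\infty(K)-J_\infty(K')|\le G_\Delta\|K-K'\|_F$ for all $K,K'\in\mathcal S(\Delta)$. 3. There exists some $\mu_\Delta>0$ such that $J_\infty$ is $\mu_\Delta$-weakly convex on any convex subset of the sublevel set $\mathcal S(\Delta)$, i.e., for any convex $C\subseteq\mathcal S(\Delta)$, the function $K\mapsto J_\infty(K)+\frac{\mu_\Delta}{2}\|K\|_F^2$ is convex on $C$.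
   Context: Notation: $\mathbb R_{++}$ is the set of positive reals; $\mathbb S_{++}^{n}$ is the set of real symmetric positive definite $n\times n$ matrices; $\preceq,\succeq$ denote the Loewner order; $\|\cdot\|_F$ is the Frobenius norm. Data: $A\in\mathbb R^{n_x\times n_x}$, $B\in\mathbb R^{n_x\times n_u}$, $B_w\in\mathbb R^{n_x\times n_w}$, $Q\in\mathbb R^{n_x\times n_x}$, $R\in\mathbb R^{n_u\times n_u}$. It is assumed that $(A,B)$ is controllable and that $Q$, $R$ and $W:=B_wB_w^{\mathsf T}$ are (symmetric) positive definite. Cost: $\mathcal K=\{K\in\mathbb R^{n_u\times n_x}: A+BK\text{ is Schur stable}\}$ (all eigenvalues of magnitude strictly less than $1$). For $K\in\mathcal K$, \[ J_\infty(K)=\left[\sup_{w:\|w\|_{\ell_2}\le1}\ \sum_{t=0}^\infty x(t)^{\mathsf T}(Q+K^{\mathsf T}RK)x(t)\right]^{1/2}, \] where $x(t+1)=(A+BK)x(t)+B_ww(t)$, $x(0)=0$, and $\|w\|_{\ell_2}=\left(\sum_{t=0}^\infty w(t)^{\mathsf T}w(t)\right)^{1/2}$. Convex lifting: the lifted set is \[ \mathfrak L_{\mathrm{lft}}=\{(K,\gamma,P)\in\mathbb R^{n_u\times n_x}\times\mathbb R_{++}\times\mathbb S_{++}^{n_x}:\mathscr M_{\mathrm{lft}}(K,\gamma,P)\preceq0\}, \] \[ \mathscr M_{\mathrm{lft}}(K,\gamma,P)=\begin{bmatrix} (A+BK)^{\mathsf T}P(A+BK)-P+Q+K^{\mathsf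 T}RK & (A+BK)^{\mathsf T}PB_w \\ B_w^{\mathsf T}P(A+BK) & B_w^{\mathsf T}PB_w-\gamma^2I \end{bmatrix}; \] the convex set is \[ \mathfrak F_{\mathrm{cvx}}=\{(\gamma,Y,X)\in\mathbb R_{++}\times\mathbb R^{n_u\times n_x}\times\mathbb S_{++}^{n_x}:\mathscr M_{\mathrm{cvx}}(\gamma,Y,X)\succeq0\}, \] \[ \mathscr M_{\mathrm{cvx}}(\gamma,Y,X)=\begin{bmatrix} X & 0 & (AX+BY)^{\mathsf T} & X & Y^{\mathsf T}\\ 0 & \gamma I & B_w^{\mathsf T} & 0 & 0\\ AX+BY & B_w & X & 0 & 0\\ X & 0 & 0 & \gamma Q^{-1} & 0\\ Y & 0 & 0 & 0 & \gamma R^{-1} \end{bmatrix}; \] and $\Phi:\mathfrak L_{\mathrm{lft}}\to\mathfrak F_{\mathrm{cvx}}$ is the bijection $\Phi(K,\gamma,P)=(\gamma,\gamma KP^{-1},\gamma P^{-1})$. *)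

theory Defs
  imports "HOL-Analysis.Analysis"
begin

(* The norm of the type real^'n^'m is the Frobenius norm. *)
lemma norm_matrix_eq_Frobenius:
  fixes M :: "real^'n^'m"
  shows "norm M = sqrt (\<Sum>i\<in>UNIV. \<Sum>j\<in>UNIV. (M $ i $ j)\<^sup>2)"
  by (simp add: norm_vec_def L2_set_def sum_nonneg)

definition psd :: "real^'n^'n \<Rightarrow> bool" where
  "psd M \<longleftrightarrow> transpose M = M \<and> (\<forall>v. v \<bullet> (M *v v) \<ge> 0)"

definition posdef :: "real^'n^'n \<Rightarrow> bool" where
  "posdef M \<longleftrightarrow> transpose M = M \<and> (\<forall>v. v \<noteq> 0 \<longrightarrow> v \<bullet> (M *v v) > 0)"

definition loewner_le :: "real^'n^'n \<Rightarrow> real^'n^'n \<Rightarrow> bool" (infix "\<preceq>\<^sub>L" 50) where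
  "M \<preceq>\<^sub>L N \<longleftrightarrow> psd (N - M)"

(* Block matrices are indexed by sum types: M ||| N puts N to the right of M,
   and M /// N puts N below M. *)

definition hcat :: "real^'a^'m \<Rightarrow> real^'b^'m \<Rightarrow> real^('a + 'b)^'m" (infixr "|||" 58) where
  "M ||| N = (\<chi> i j. case j of Inl a \<Rightarrow> M $ i $ a | Inr b \<Rightarrow> N $ i $ b)"

definition vcat :: "real^'m^'a \<Rightarrow> real^'m^'b \<Rightarrow> real^'m^('a + 'b)" (infixr "'/'/'/" 55) where
  "M /// N = (\<chi> i. case i of Inl a \<Rightarrow> M $ a | Inr b \<Rightarrow> N $ b)"

(* The iterated ((**) A ^^ k) B is the matrix product A^k B.  The dimension of the span
   of the columns of B, A B, ..., A^(n-1) B is the rank of the Kalman matrix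
   [B, A B, ..., A^(n-1) B], so this says that the Kalman matrix has full row rank. *)
definition controllable :: "real^'nx^'nx \<Rightarrow> real^'nu^'nx \<Rightarrow> bool" where
  "controllable A B \<longleftrightarrow>
     dim (\<Union>k<CARD('nx). columns (((**) A ^^ k) B)) = CARD('nx)"

definition schur_stable :: "real^'n^'n \<Rightarrow> bool" where
  "schur_stable M \<longleftrightarrow>
     (\<forall>(l::complex) v. v \<noteq> 0 \<longrightarrow> map_matrix complex_of_real M *v v = l *s v \<longrightarrow> cmod l < 1)"

definition stabilizing :: "real^'nx^'nx \<Rightarrow> real^'nu^'nx \<Rightarrow> (real^'nx^'nu) set" where
  "stabilizing A B = {K. schur_stable (A + B ** K)}"

primrec state ::
  "real^'nx^'nx \<Rightarrow> real^'nu^'nx \<Rightarrow> real^'nw^'nx \<Rightarrow> real^'nx^'nu \<Rightarrow> (nat \<Rightarrow> real^'nw) \<Rightarrow> nat \<Rightarrow> real^'nx"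
where
  "state A B Bw K w 0 = 0"
| "state A B Bw K w (Suc t) = (A + B ** K) *v state A B Bw K w t + Bw *v w t"

definition l2_unit_ball :: "(nat \<Rightarrow> real^'n) set" where
  "l2_unit_ball = {w. summable (\<lambda>t. w t \<bullet> w t) \<and> sqrt (\<Sum>t. w t \<bullet> w t) \<le> 1}"

(* For stabilizing K the series converges for every w in the unit ball of l2 and the
   supremum is over a nonempty bounded set; J_inf is only meaningful for such K. *)
definition J_inf ::
  "real^'nx^'nx \<Rightarrow> real^'nu^'nx \<Rightarrow> real^'nw^'nx \<Rightarrow> real^'nx^'nx \<Rightarrow> real^'nu^'nu \<Rightarrow> real^'nx^'nu \<Rightarrow> real"
where
  "J_inf A B Bw Q R K = sqrt (SUP w \<in> l2_unit_ball.
     \<Sum>t. state A B Bw K w t \<bullet> ((Q + transpose K ** R ** K) *v state A B Bw K w t))"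

definition sublevel ::
  "real^'nx^'nx \<Rightarrow> real^'nu^'nx \<Rightarrow> real^'nw^'nx \<Rightarrow> real^'nx^'nx \<Rightarrow> real^'nu^'nu \<Rightarrow> real
     \<Rightarrow> (real^'nx^'nu) set"
where
  "sublevel A B Bw Q R \<Delta> = {K \<in> stabilizing A B. J_inf A B Bw Q R K \<le> \<Delta>}"

definition M_lft ::
  "real^'nx^'nx \<Rightarrow> real^'nu^'nx \<Rightarrow> real^'nw^'nx \<Rightarrow> real^'nx^'nx \<Rightarrow> real^'nu^'nu
     \<Rightarrow> real^'nx^'nu \<Rightarrow> real \<Rightarrow> real^'nx^'nx \<Rightarrow> real^('nx + 'nw)^('nx + 'nw)"
where
  "M_lft A B Bw Q R K \<gamma> P =
     (transpose (A + B ** K) ** P ** (A + B ** K) - P + Q + transpose K ** R ** K)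
                                           ||| (transpose (A + B ** K) ** P ** Bw)
     /// (transpose Bw ** P ** (A + B ** K)) ||| (transpose Bw ** P ** Bw - \<gamma>\<^sup>2 *\<^sub>R mat 1)"

definition L_lft ::
  "real^'nx^'nx \<Rightarrow> real^'nu^'nx \<Rightarrow> real^'nw^'nx \<Rightarrow> real^'nx^'nx \<Rightarrow> real^'nu^'nu
     \<Rightarrow> ((real^'nx^'nu) \<times> real \<times> (real^'nx^'nx)) set"
where
  "L_lft A B Bw Q R =
     {(K, \<gamma>, P). \<gamma> > 0 \<and> posdef P \<and> M_lft A B Bw Q R K \<gamma> P \<preceq>\<^sub>L 0}"

definition M_cvx ::
  "real^'nx^'nx \<Rightarrow> real^'nu^'nx \<Rightarrow> real^'nw^'nx \<Rightarrow> real^'nx^'nx \<Rightarrow> real^'nu^'nu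
     \<Rightarrow> real \<Rightarrow> real^'nx^'nu \<Rightarrow> real^'nx^'nx
     \<Rightarrow> real^('nx + 'nw + 'nx + 'nx + 'nu)^('nx + 'nw + 'nx + 'nx + 'nu)"
where
  "M_cvx A B Bw Q R \<gamma> Y X =
         X ||| 0 ||| transpose (A ** X + B ** Y) ||| X ||| transpose Y
     /// 0 ||| (\<gamma> *\<^sub>R mat 1) ||| transpose Bw ||| 0 ||| 0
     /// (A ** X + B ** Y) ||| Bw ||| X ||| 0 ||| 0
     /// X ||| 0 ||| 0 ||| (\<gamma> *\<^sub>R matrix_inv Q) ||| 0
     /// Y ||| 0 ||| 0 ||| 0 ||| (\<gamma> *\<^sub>R matrix_inv R)"

definition F_cvx ::
  "real^'nx^'nx \<Rightarrow> real^'nu^'nx \<Rightarrow> real^'nw^'nx \<Rightarrow> real^'nx^'nx \<Rightarrow> real^'nu^'nu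
     \<Rightarrow> (real \<times> (real^'nx^'nu) \<times> (real^'nx^'nx)) set"
where
  "F_cvx A B Bw Q R =
     {(\<gamma>, Y, X). \<gamma> > 0 \<and> posdef X \<and> 0 \<preceq>\<^sub>L M_cvx A B Bw Q R \<gamma> Y X}"

definition Phi ::
  "(real^'nx^'nu) \<times> real \<times> (real^'nx^'nx) \<Rightarrow> real \<times> (real^'nx^'nu) \<times> (real^'nx^'nx)"
where
  "Phi = (\<lambda>(K, \<gamma>, P). (\<gamma>, \<gamma> *\<^sub>R (K ** matrix_inv P), \<gamma> *\<^sub>R matrix_inv P))"

end

theory Submission
  imports Defs "HOL-Computational_Algebra.Fundamental_Theorem_Algebra"
begin

text \<open>
  \<open>J K\<close> is the supremum, over disturbances \<open>w\<close> in the unit ball and horizons \<open>T\<close>, of the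
  \<open>l2\<close> norm over \<open>{..<T}\<close> of the output \<open>(x, K x)\<close>, measured with the weights \<open>Q\<close> and \<open>R\<close>.
  Since \<open>Bw\<close> has a right inverse, \<open>J K \<le> \<Delta>\<close> gives, uniformly over the sublevel set, a bound on
  the response of the closed loop to an arbitrary additive perturbation. The difference of the
  trajectories of \<open>K\<close> and \<open>K'\<close> is the response of the closed loop of \<open>K\<close> to \<open>B (K - K') x'\<close>,
  whence the Lipschitz bound. For \<open>K = (1 - \<theta>) K0 + \<theta> K1\<close> the deviation of its trajectory from the
  same combination of the trajectories \<open>x0\<close>, \<open>x1\<close> is the response to
  \<open>\<theta> (1 - \<theta>) B (K1 - K0) (x0 - x1)\<close>, hence of size at most
  a constant times \<open>\<theta> (1 - \<theta>) (norm (K0 - K1))^2\<close>. So \<open>J\<close> is a supremum of uniformly weakly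
  convex functions.

  Compactness is read off the diagonal blocks of \<open>M_lft\<close>: these give
  \<open>Q + K^T R K \<preceq>\<^sub>L P\<close> and bound \<open>P\<close> by a multiple of \<open>\<gamma>^2\<close>.
\<close>

subsection \<open>Powers of a Schur stable matrix\<close>

text \<open>Applied to the orbit \<open>v, M v, M^2 v, ...\<close> this supplies a nonzero
  polynomial annihilating \<open>v\<close>. The vectors form an indexed family, so a repetition
  \<open>f i = f j\<close> is itself a relation and is separated from dependence of the image
  set.\<close>

lemma exists_linear_relation:
  fixes f :: "nat \<Rightarrow> 'a::euclidean_space"
  shows "\<exists>a::nat \<Rightarrow> real. (\<exists>i\<le>DIM('a). a i \<noteq> 0) \<and> (\<Sum>i\<le>DIM('a). a i *\<^sub>R f i) = 0"
proof (cases "inj_on f {..DIM('a)}")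
  case False
  then obtain i j where ij: "i \<le> DIM('a)" "j \<le> DIM('a)" "i \<noteq> j" "f i = f j"
    by (auto simp: inj_on_def)
  define a :: "nat \<Rightarrow> real" where "a k = (if k = i then 1 else if k = j then -1 else 0)" for k
  have "(\<Sum>k\<le>DIM('a). a k *\<^sub>R f k) = (\<Sum>k\<in>{i,j}. a k *\<^sub>R f k)"
    by (rule sum.mono_neutral_right) (use ij in \<open>auto simp: a_def\<close>)
  then have "(\<Sum>k\<le>DIM('a). a k *\<^sub>R f k) = 0" using ij by (simp add: a_def)
  moreover have "a i \<noteq> 0" by (simp add: a_def)
  ultimately show ?thesis using ij by blast
next
  case True
  then have "card (f ` {..DIM('a)}) = Suc DIM('a)" by (simp add: card_image)
  then have "dependent (f ` {..DIM('a)})" by (intro dependent_biggerset) auto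
  then obtain u where u: "\<exists>v\<in>f ` {..DIM('a)}. u v \<noteq> 0" "(\<Sum>v\<in>f ` {..DIM('a)}. u v *\<^sub>R v) = 0"
    by (auto simp: dependent_finite)
  then show ?thesis using True by (intro exI[of _ "u \<circ> f"]) (auto simp: sum.reindex)
qed

lemma funpow_matrix_diff_scale:
  fixes M :: "'a::field^'n^'n"
  shows "(((*v) M) ^^ k) (x - c *s y) = (((*v) M) ^^ k) x - c *s ((((*v) M) ^^ k) y)"
  by (induction k) (simp_all add: vec.diff vec.scale)

lemma summable_norm_recurrence:
  fixes f g :: "nat \<Rightarrow> real"
  assumes r: "0 \<le> r" "r < 1" and f: "\<And>k. 0 \<le> f k" and rec: "\<And>k. f (Suc k) \<le> r * f k + g k"
    and g: "\<And>k. 0 \<le> g k" "summable g"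
  shows "summable f"
proof -
  have "(1 - r) * (\<Sum>k<n. f k) \<le> f 0 + (\<Sum>k<n. g k)" for n
  proof -
    have "(\<Sum>k<n. f k) \<le> (\<Sum>k<Suc n. f k)" using f by simp
    also have "\<dots> = f 0 + (\<Sum>k<n. f (Suc k))" by (rule sum.lessThan_Suc_shift)
    also have "\<dots> \<le> f 0 + (\<Sum>k<n. r * f k + g k)" by (intro add_mono sum_mono rec) simp
    finally show ?thesis by (simp add: sum.distrib sum_distrib_left[symmetric] algebra_simps)
  qed
  moreover have "(\<Sum>k<n. g k) \<le> suminf g" for n using g by (intro sum_le_suminf) auto
  ultimately have "(1 - r) * (\<Sum>k<n. f k) \<le> f 0 + suminf g" for n
    by (meson add_left_mono order_trans)
  then have "(\<Sum>k<n. f k) \<le> (f 0 + suminf g) / (1 - r)" for n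
    using r by (simp add: pos_le_divide_eq mult.commute)
  then show ?thesis by (intro summableI_nonneg_bounded f)
qed

lemma norm_vector_scalar_mult:
  fixes c :: "'a::real_normed_field" shows "norm (c *s x) = norm c * norm x"
  by (simp add: norm_vec_def norm_mult L2_set_def power_mult_distrib sum_distrib_left[symmetric] real_sqrt_mult)

text \<open>A linear factor \<open>M - z\<close> of the annihilating polynomial is either invertible, and then it can be
  cancelled, or \<open>z\<close> is an eigenvalue, so that the iterates obey a scalar recurrence with ratio
  \<open>cmod z < 1\<close>.\<close>

lemma summable_iterates_of_annihilated:
  fixes M :: "complex^'n^'n"
  assumes M: "\<And>l v. v \<noteq> 0 \<Longrightarrow> M *v v = l *s v \<Longrightarrow> cmod l < 1"
    and "p \<noteq> 0" "(\<Sum>i\<le>degree p. coeff p i *s (((*v) M) ^^ i) v) = 0"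
  shows "summable (\<lambda>k. norm ((((*v) M) ^^ k) v))"
  using assms(2,3)
proof (induction "degree p" arbitrary: p v)
  case 0
  then have "v = 0" by (auto elim: degree_eq_zeroE simp: vec_eq_iff)
  moreover have "(((*v) M) ^^ k) 0 = 0" for k by (induction k) auto
  ultimately show ?case by simp
next
  case (Suc n)
  let ?F = "\<lambda>k. ((*v) M) ^^ k"
  have "\<not> constant (poly p)" using Suc.hyps(2) by (simp add: constant_degree)
  then obtain z where "poly p z = 0" using fundamental_theorem_of_algebra by blast
  then obtain q where q: "p = [:- z, 1:] * q" by (auto simp: poly_eq_0_iff_dvd)
  with Suc.prems have q0: "q \<noteq> 0" by auto
  then have "degree p = 1 + degree q" unfolding q by (subst degree_mult_eq) auto
  with Suc.hyps(2) have dq: "degree q = n" by simp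
  \<comment> \<open>With \<open>p = (X - z) q\<close>, the vector \<open>u = (M - z) v\<close> is
    annihilated by \<open>q\<close>, whose degree is smaller by one. The computation below is
    \<open>p(M) v = q(M) u\<close> written in coefficients.\<close>
  define u where "u = M *v v - z *s v"
  have Fu: "?F k u = ?F (Suc k) v - z *s ?F k v" for k
    unfolding u_def funpow_matrix_diff_scale by (simp add: funpow_swap1)
  have c0: "coeff p 0 = - z * coeff q 0" using q by simp
  have cS: "coeff p (Suc i) = coeff q i - z * coeff q (Suc i)" for i using q by simp
  have "0 = (\<Sum>i\<le>Suc n. coeff p i *s ?F i v)" using Suc.prems Suc.hyps(2) by simp
  also have "\<dots> = - (z * coeff q 0) *s ?F 0 v + (\<Sum>i\<le>n. coeff q i *s ?F (Suc i) v)
       - (\<Sum>i\<le>n. (z * coeff q (Suc i)) *s ?F (Suc i) v)"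
    unfolding sum.atMost_Suc_shift c0 cS
    by (simp add: sum_subtractf vector_sub_rdistrib)
  also have "\<dots> = (\<Sum>i\<le>n. coeff q i *s ?F (Suc i) v) - (\<Sum>i\<le>Suc n. (z * coeff q i) *s ?F i v)"
    unfolding sum.atMost_Suc_shift by simp
  \<comment> \<open>The top term drops out because \<open>Suc n\<close> exceeds the degree of
    \<open>q\<close>.\<close>
  also have "\<dots> = (\<Sum>i\<le>n. coeff q i *s ?F (Suc i) v) - (\<Sum>i\<le>n. (z * coeff q i) *s ?F i v)"
    using dq by (simp add: coeff_eq_0)
  also have "\<dots> = (\<Sum>i\<le>n. coeff q i *s ?F i u)"
    unfolding Fu by (simp add: sum_subtractf vector_ssub_ldistrib vector_smult_assoc mult.commute)
  finally have "(\<Sum>i\<le>degree q. coeff q i *s ?F i u) = 0" using dq by simp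
  then have su: "summable (\<lambda>k. norm (?F k u))" using Suc.hyps(1) dq q0 by blast
  show ?case
  \<comment> \<open>The split is on the modulus of \<open>z\<close>. Below 1 the iterates of
    \<open>v\<close> obey a contracting recurrence driven by those of \<open>u\<close>. Otherwise
    \<open>z\<close> cannot be an eigenvalue, so \<open>M - z\<close> is injective and its left
    inverse \<open>E\<close> recovers the iterates of \<open>v\<close> from those of
    \<open>u\<close>.\<close>
  proof (cases "cmod z < 1")
    case True
    have "norm (?F (Suc k) v) \<le> cmod z * norm (?F k v) + norm (?F k u)" for k
    proof -
      have "?F (Suc k) v = z *s ?F k v + ?F k u" unfolding Fu by simp
      then show ?thesis using norm_triangle_ineq[of "z *s ?F k v" "?F k u"]
        by (simp add: norm_vector_scalar_mult)
    qed
    from summable_norm_recurrence[OF _ True _ this _ su] show ?thesis by simp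
  next
    case False
    define D where "D = M - mat z"
    have Dv: "D *v x = M *v x - z *s x" for x
      unfolding D_def by (simp add: vec_eq_iff
          matrix_vector_mult_def mat_def left_diff_distrib sum_subtractf
          if_distrib[of "\<lambda>c. c * _"] cong: if_cong)
    have "x = 0" if "D *v x = 0" for x using M[of x z] that False by (auto simp: Dv)
    then obtain E where E: "E ** D = mat 1" using matrix_left_invertible_ker by blast
    have EF: "E *v ?F k u = ?F k v" for k
    proof -
      have "?F k u = D *v ?F k v" unfolding Fu Dv by simp
      then show ?thesis by (simp add: matrix_vector_mul_assoc E)
    qed
    have "bounded_linear ((*v) E)"
      by (rule linear_conv_bounded_linear[THEN iffD1], rule linearI)
         (simp_all add: vec_eq_iff matrix_vector_mult_def scaleR_sum_right
             sum.distrib distrib_left)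
    then obtain C where "\<And>x. norm (E *v x) \<le> norm x * C"
      using bounded_linear.bounded by blast
    then have "norm (?F k v) \<le> norm (?F k u) * C" for k by (metis EF)
    then show ?thesis
      by (intro summable_comparison_test[OF _ summable_mult2[OF su, of C]]) auto
  qed
qed

definition complexify :: "real^'n \<Rightarrow> complex^'n" where
  "complexify v = (\<chi> i. complex_of_real (v $ i))"

lemma norm_complexify: "norm (complexify v) = norm v"
  by (simp add: complexify_def norm_vec_def)

lemma complexify_mult:
  "map_matrix complex_of_real M *v complexify v = complexify (M *v v)"
  by (simp add: complexify_def map_matrix_def vec_eq_iff matrix_vector_mult_def)

text \<open>A relation among \<open>v\<close> and its first \<open>CARD('n)\<close> iterates serves
  as annihilating polynomial of this one vector. Roots and eigenvalues require complex scalars, so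
  the orbit is complexified, which preserves norms.\<close>

lemma schur_stable_summable:
  fixes M :: "real^'n^'n"
  assumes "schur_stable M"
  shows "summable (\<lambda>k. norm ((((*v) M) ^^ k) v))"
proof -
  let ?M = "map_matrix complex_of_real M"
  have it: "(((*v) ?M) ^^ k) (complexify v) = complexify ((((*v) M) ^^ k) v)" for k
    by (induction k) (simp_all add: complexify_mult)
  obtain a :: "nat \<Rightarrow> real" where a: "\<exists>i\<le>CARD('n). a i \<noteq> 0"
      "(\<Sum>i\<le>CARD('n). a i *\<^sub>R (((*v) M) ^^ i) v) = 0"
    using exists_linear_relation[of "\<lambda>i. (((*v) M) ^^ i) v"] by auto
  define p where "p = Poly (map (\<lambda>i. complex_of_real (a i)) [0..<Suc CARD('n)])"
  have cp: "coeff p i = (if i \<le> CARD('n) then complex_of_real (a i) else 0)" for i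
    by (auto simp: p_def nth_default_def simp del: upt_Suc)
  have p0: "p \<noteq> 0" using a(1) cp by (metis coeff_0 of_real_eq_0_iff)
  have dp: "degree p \<le> CARD('n)" by (rule degree_le) (simp add: cp)
  \<comment> \<open>Leading coefficients of the relation may vanish, so \<open>degree p\<close> can
    lie below \<open>CARD('n)\<close>; the terms in between are zero.\<close>
  have "(\<Sum>i\<le>degree p. coeff p i *s (((*v) ?M) ^^ i) (complexify v))
      = (\<Sum>i\<le>CARD('n). coeff p i *s (((*v) ?M) ^^ i) (complexify v))"
    by (rule sum.mono_neutral_left) (use dp in \<open>auto simp: coeff_eq_0\<close>)
  also have "\<dots> = complexify (\<Sum>i\<le>CARD('n). a i *\<^sub>R (((*v) M) ^^ i) v)"
    unfolding it by (simp add: cp vec_eq_iff complexify_def)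
  also have "\<dots> = 0" unfolding a(2) by (simp add: complexify_def vec_eq_iff)
  finally have "summable (\<lambda>k. norm ((((*v) ?M) ^^ k) (complexify v)))"
    using assms p0 unfolding schur_stable_def
    by (intro summable_iterates_of_annihilated[of ?M p]) auto
  then show ?thesis by (simp add: it norm_complexify)
qed

subsection \<open>Finite gain of stable systems\<close>

text \<open>Cauchy-Schwarz on each row: the Frobenius norm dominates the operator norm.\<close>

lemma mat_vec_norm_le:
  fixes M :: "real^'n^'m" shows "norm (M *v v) \<le> norm M * norm v"
proof -
  have "norm (M *v v) = L2_set (\<lambda>i. (M $ i) \<bullet> v) UNIV"
    by (simp add: norm_vec_def matrix_mult_dot L2_set_def)
  also have "\<dots> \<le> L2_set (\<lambda>i. norm (M $ i) * norm v) UNIV"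
    unfolding L2_set_def
    by (intro real_sqrt_le_mono sum_mono abs_le_square_iff[THEN iffD1])
       (simp add: Cauchy_Schwarz_ineq2)
  also have "\<dots> = norm M * norm v"
    by (simp add: L2_set_left_distrib[symmetric] norm_vec_def)
  finally show ?thesis .
qed

lemma L2_norm_mat_vec_le:
  fixes M :: "real^'n^'m"
  shows "L2_set (\<lambda>t. norm (M *v f t)) S \<le> norm M * L2_set (\<lambda>t. norm (f t)) S"
proof -
  have "L2_set (\<lambda>t. norm (M *v f t)) S \<le> L2_set (\<lambda>t. norm M * norm (f t)) S"
    by (intro L2_set_mono mat_vec_norm_le) auto
  then show ?thesis by (simp add: L2_set_right_distrib)
qed

lemma mat_norm_le_entries:
  fixes M :: "real^'n^'m" and c :: real
  assumes "\<And>i j. \<bar>M $ i $ j\<bar> \<le> c"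
  shows "norm M \<le> CARD('m) * (CARD('n) * c)"
proof -
  have "norm M \<le> (\<Sum>i\<in>UNIV. norm (M $ i))" by (simp add: norm_vec_def L2_set_le_sum)
  also have "\<dots> \<le> (\<Sum>i\<in>(UNIV::'m set). real CARD('n) * c)"
  proof (rule sum_mono)
    fix i :: 'm
    have "norm (M $ i) \<le> (\<Sum>j\<in>UNIV. \<bar>M $ i $ j\<bar>)" by (rule norm_le_l1_cart)
    also have "\<dots> \<le> (\<Sum>j\<in>(UNIV::'n set). c)" by (intro sum_mono assms)
    finally show "norm (M $ i) \<le> real CARD('n) * c" by simp
  qed
  finally show ?thesis by simp
qed

text \<open>For a Schur stable \<open>M\<close> the norm \<open>N v = (\<Sum>k. norm (M^k v))\<close> is contracted by \<open>M\<close>,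
  because \<open>N (M v) = N v - norm v\<close> and \<open>N v \<le> C * norm v\<close>.\<close>

lemma schur_stable_contracted_norm:
  fixes M :: "real^'n^'n"
  assumes "schur_stable M"
  obtains N \<rho> C where "0 \<le> \<rho>" "\<rho> < 1" "0 \<le> C" "\<And>v. norm v \<le> N v" "\<And>v. N v \<le> C * norm v"
    "\<And>v u. N (v + u) \<le> N v + N u" "\<And>v. N (M *v v) \<le> \<rho> * N v"
proof -
  let ?F = "\<lambda>k. ((*v) M) ^^ k"
  note summ = schur_stable_summable[OF assms]
  define N where "N v = (\<Sum>k. norm (?F k v))" for v
  have Fadd: "?F k (v + u) = ?F k v + ?F k u" for k v u
    by (induction k) (simp_all add: vec.add)
  have Fscale: "?F k (c *\<^sub>R v) = c *\<^sub>R ?F k v" for k c v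
    by (induction k) (simp_all add: matrix_vector_mult_scaleR)
  have tri: "N (v + u) \<le> N v + N u" for v u
    unfolding N_def suminf_add[OF summ summ]
    by (intro suminf_le summ summable_add) (simp_all add: Fadd norm_triangle_ineq)
  have scale: "N (c *\<^sub>R v) = \<bar>c\<bar> * N v" for c v
    unfolding N_def by (simp add: Fscale suminf_mult summ)
  have N0: "N 0 = 0" using scale[of 0 0] by simp
  have Nsum: "N (\<Sum>i\<in>S. f i) \<le> (\<Sum>i\<in>S. N (f i))" if "finite S" for S and f :: "'n \<Rightarrow> real^'n"
    using that by induction (auto simp: N0 intro: order_trans[OF tri])
  have Nnn: "N v \<ge> 0" for v unfolding N_def by (intro suminf_nonneg summ) simp
  have le: "norm v \<le> N v" for v
    using sum_le_suminf[OF summ, of "{0}" v] by (simp add: N_def)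
  have step: "N v = norm v + N (M *v v)" for v
    unfolding N_def using suminf_split_head[OF summ, of v] by (simp add: funpow_swap1)
  \<comment> \<open>The sum bounds \<open>N\<close> through the expansion in the standard basis; the
    added 1 gives \<open>C \<ge> 1\<close>, so that the ratio \<open>1 - 1 / C\<close> lies in [0,
    1).\<close>
  define C where "C = 1 + (\<Sum>i\<in>UNIV. N (axis i 1))"
  have C: "C \<ge> 1" unfolding C_def by (simp add: sum_nonneg Nnn)
  have ub: "N v \<le> C * norm v" for v
  proof -
    have "N v = N (\<Sum>i\<in>UNIV. (v $ i) *\<^sub>R axis i 1)"
      by (metis (no_types, lifting) basis_expansion scalar_mult_eq_scaleR sum.cong)
    also have "\<dots> \<le> (\<Sum>i\<in>UNIV. \<bar>v $ i\<bar> * N (axis i 1))"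
      by (rule order_trans[OF Nsum]) (simp_all add: scale)
    also have "\<dots> \<le> (\<Sum>i\<in>UNIV. norm v * N (axis i 1))"
      by (intro sum_mono mult_right_mono component_le_norm_cart Nnn)
    also have "\<dots> \<le> C * norm v" by (simp add: C_def sum_distrib_left algebra_simps)
    finally show ?thesis .
  qed
  have "N (M *v v) \<le> (1 - 1 / C) * N v" for v
    using step[of v] ub[of v] C by (simp add: field_simps)
  with C le ub tri show ?thesis by (intro that[of "1 - 1/C" C N]) auto
qed

text \<open>Since \<open>f 0 = 0\<close>, the norm of \<open>f\<close> over \<open>Suc T\<close>
  terms is that of the shifted sequence, to which the recurrence and Minkowski apply. Working on
  finite horizons avoids presupposing that \<open>f\<close> is square summable.\<close>

lemma L2_set_recurrence_le:
  assumes "f 0 = 0" "\<And>t. 0 \<le> f t" "0 \<le> r" "r < 1" "\<And>t. f (Suc t) \<le> r * f t + g t" "\<And>t. 0 \<le> g t"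
  shows "(1 - r) * L2_set f {..<T} \<le> L2_set g {..<T}"
proof -
  have "L2_set f {..<T} \<le> L2_set f {..<Suc T}" by (simp add: L2_set_def)
  also have "\<dots> = L2_set (\<lambda>t. f (Suc t)) {..<T}"
    unfolding L2_set_def by (simp add: sum.lessThan_Suc_shift assms(1) del: sum.lessThan_Suc)
  also have "\<dots> \<le> L2_set (\<lambda>t. r * f t + g t) {..<T}" by (intro L2_set_mono assms)
  also have "\<dots> \<le> L2_set (\<lambda>t. r * f t) {..<T} + L2_set g {..<T}" by (rule L2_set_triangle_ineq)
  also have "L2_set (\<lambda>t. r * f t) {..<T} = r * L2_set f {..<T}"
    using assms by (simp add: L2_set_right_distrib)
  finally show ?thesis by (simp add: algebra_simps)
qed

text \<open>In the contracted norm the state obeys a scalar recurrence. The gain obtained depends on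
  \<open>M\<close> alone, neither on the perturbation nor on the horizon.\<close>

lemma schur_stable_l2_gain:
  fixes M :: "real^'n^'n"
  assumes "schur_stable M"
  obtains c where "c \<ge> 0" "\<And>x d T. x 0 = 0 \<Longrightarrow> (\<And>t. x (Suc t) = M *v x t + d t) \<Longrightarrow>
      L2_set (\<lambda>t. norm (x t)) {..<T} \<le> c * L2_set (\<lambda>t. norm (d t)) {..<T}"
proof -
  obtain N \<rho> C where N: "0 \<le> \<rho>" "\<rho> < 1" "0 \<le> C" "\<And>v. norm v \<le> N v" "\<And>v. N v \<le> C * norm v"
    "\<And>v u. N (v + u) \<le> N v + N u" "\<And>v. N (M *v v) \<le> \<rho> * N v"
    using schur_stable_contracted_norm[OF assms] by (rule schur_stable_contracted_norm[OF assms]) (rule that)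
  show ?thesis
  proof (rule that[of "C / (1 - \<rho>)"])
    fix x d :: "nat \<Rightarrow> real^'n" and T
    assume x: "x 0 = 0" "\<And>t. x (Suc t) = M *v x t + d t"
    have Nnn: "0 \<le> N v" for v using N(4)[of v] norm_ge_zero order_trans by blast
    have "L2_set (\<lambda>t. norm (x t)) {..<T} \<le> L2_set (\<lambda>t. N (x t)) {..<T}"
      by (intro L2_set_mono N) simp
    moreover
    have "(1 - \<rho>) * L2_set (\<lambda>t. N (x t)) {..<T} \<le> L2_set (\<lambda>t. C * norm (d t)) {..<T}"
    proof (rule L2_set_recurrence_le)
      show "N (x 0) = 0" using N(5)[of 0] Nnn[of 0] x by simp
      show "N (x (Suc t)) \<le> \<rho> * N (x t) + C * norm (d t)" for t
        unfolding x by (rule order_trans[OF N(6)]) (intro add_mono N)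
    qed (use N Nnn in auto)
    then have "L2_set (\<lambda>t. N (x t)) {..<T} \<le> C / (1 - \<rho>) * L2_set (\<lambda>t. norm (d t)) {..<T}"
      using N by (simp add: L2_set_right_distrib[symmetric] pos_le_divide_eq mult.commute)
    ultimately show "L2_set (\<lambda>t. norm (x t)) {..<T} \<le> C / (1 - \<rho>) * L2_set (\<lambda>t. norm (d t)) {..<T}"
      by linarith
  qed (use N in auto)
qed

subsection \<open>Positive definite forms\<close>

text \<open>The constant is the minimum of the form on the compact unit sphere; homogeneity extends
  the bound to all vectors.\<close>

lemma posdef_lower_bound:
  fixes M :: "real^'n^'n"
  assumes "posdef M"
  obtains c where "c > 0" "\<And>v. c * (norm v)\<^sup>2 \<le> v \<bullet> (M *v v)"
proof -
  have cont: "continuous_on (sphere 0 1) (\<lambda>v. v \<bullet> (M *v v))"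
    by (intro continuous_intros)
  have "axis undefined 1 \<in> sphere (0 :: real^'n) 1" by simp
  then have ne: "sphere (0 :: real^'n) 1 \<noteq> {}" by blast
  obtain u where u: "u \<in> sphere (0 :: real^'n) 1" "\<And>v. v \<in> sphere 0 1 \<Longrightarrow> u \<bullet> (M *v u) \<le> v \<bullet> (M *v v)"
    using continuous_attains_inf[OF compact_sphere ne cont] by blast
  have "u \<noteq> 0" using u(1) by auto
  then have pos: "u \<bullet> (M *v u) > 0" using assms by (simp add: posdef_def)
  have "u \<bullet> (M *v u) * (norm v)\<^sup>2 \<le> v \<bullet> (M *v v)" for v
  proof (cases "v = 0")
    case False
    then have "u \<bullet> (M *v u) \<le> sgn v \<bullet> (M *v sgn v)" by (intro u(2)) (simp add: norm_sgn)
    also have "\<dots> = (v \<bullet> (M *v v)) / (norm v)\<^sup>2"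
      by (simp add: sgn_div_norm matrix_vector_mult_scaleR power2_eq_square field_simps)
    finally show ?thesis using False by (simp add: field_simps)
  qed simp
  with pos show ?thesis by (rule that)
qed

lemma posdef_imp_psd: "posdef M \<Longrightarrow> psd M"
  unfolding posdef_def psd_def by (metis inner_zero_left less_imp_le order_refl)

lemma inner_matrix_commute:
  fixes M :: "real^'n^'n" assumes "transpose M = M" shows "u \<bullet> (M *v v) = v \<bullet> (M *v u)"
  by (metis assms dot_lmul_matrix inner_commute transpose_matrix_vector)

lemma psd_Cauchy_Schwarz:
  fixes M :: "real^'n^'n"
  assumes "psd M"
  shows "(u \<bullet> (M *v v))\<^sup>2 \<le> (u \<bullet> (M *v u)) * (v \<bullet> (M *v v))"
proof -
  let ?a = "u \<bullet> (M *v u)" and ?b = "u \<bullet> (M *v v)" and ?c = "v \<bullet> (M *v v)"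
  have sym: "v \<bullet> (M *v u) = ?b" using assms by (intro inner_matrix_commute) (simp add: psd_def)
  have nn: "0 \<le> w \<bullet> (M *v w)" for w using assms by (simp add: psd_def)
  have quad: "0 \<le> ?a * s\<^sup>2 - 2 * s * t * ?b + ?c * t\<^sup>2" for s t
    using nn[of "s *\<^sub>R u - t *\<^sub>R v"] sym
    by (simp add: matrix_vector_mult_diff_distrib matrix_vector_mult_scaleR inner_diff_left
        inner_diff_right power2_eq_square algebra_simps)
  show ?thesis
  proof (cases "?c = 0")
    case True
    have "?b = 0"
    proof (rule ccontr)
      assume "?b \<noteq> 0"
      \<comment> \<open>With \<open>?c = 0\<close> the quadratic is affine in \<open>t\<close>, and
        this \<open>t\<close> gives it the value -1.\<close>
      then show False using quad[of 1 "(?a + 1) / (2 * ?b)"] True nn[of u] by simp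
    qed
    with True show ?thesis by simp
  next
    case False
    then have c: "?c > 0" using nn[of v] by simp
    \<comment> \<open>The choice \<open>s = ?c\<close>, \<open>t = ?b\<close> minimises the
      quadratic up to scaling.\<close>
    have "0 \<le> ?c * (?a * ?c - ?b\<^sup>2)"
      using quad[of ?c ?b] by (simp add: power2_eq_square algebra_simps)
    with c show ?thesis by (simp add: zero_le_mult_iff)
  qed
qed

lemma psd_sqrt_form_triangle:
  fixes M :: "real^'n^'n"
  assumes "psd M"
  shows "sqrt ((u + v) \<bullet> (M *v (u + v))) \<le> sqrt (u \<bullet> (M *v u)) + sqrt (v \<bullet> (M *v v))"
proof (rule real_le_lsqrt)
  have nn: "0 \<le> w \<bullet> (M *v w)" for w using assms by (simp add: psd_def)
  have "u \<bullet> (M *v v) \<le> sqrt (u \<bullet> (M *v u)) * sqrt (v \<bullet> (M *v v))"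
    unfolding real_sqrt_mult[symmetric] using psd_Cauchy_Schwarz[OF assms]
    by (meson real_le_rsqrt)
  moreover have "v \<bullet> (M *v u) = u \<bullet> (M *v v)"
    using assms by (intro inner_matrix_commute) (simp add: psd_def)
  ultimately show "(u + v) \<bullet> (M *v (u + v)) \<le> (sqrt (u \<bullet> (M *v u)) + sqrt (v \<bullet> (M *v v)))\<^sup>2"
    using nn by (simp add: power2_sum matrix_vector_right_distrib inner_add_left inner_add_right)
  show "0 \<le> sqrt (u \<bullet> (M *v u)) + sqrt (v \<bullet> (M *v v))" using nn by simp
qed

text \<open>The exact convexity defect of the squared norm; it is what absorbs the second-order
  error of the cost.\<close>

lemma norm_convex_combination:
  fixes u v :: "'a::real_inner"
  shows "(norm ((1 - \<theta>) *\<^sub>R u + \<theta> *\<^sub>R v))\<^sup>2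
    = (1 - \<theta>) * (norm u)\<^sup>2 + \<theta> * (norm v)\<^sup>2 - \<theta> * (1 - \<theta>) * (norm (u - v))\<^sup>2"
  by (simp add: power2_norm_eq_inner inner_commute[of v u] algebra_simps)

subsection \<open>The cost as a supremum of truncated trajectory norms\<close>

text \<open>State and input are separate arguments, without substituting \<open>u = K v\<close>, so
  that differences of outputs produced by different gains can also be measured.\<close>

definition stage_norm :: "real^'n^'n \<Rightarrow> real^'m^'m \<Rightarrow> real^'n \<Rightarrow> real^'m \<Rightarrow> real" where
  "stage_norm Q R v u = sqrt (v \<bullet> (Q *v v) + u \<bullet> (R *v u))"

locale state_feedback =
  fixes A :: "real^'nx^'nx" and B :: "real^'nu^'nx" and Bw :: "real^'nw^'nx"
    and Q :: "real^'nx^'nx" and R :: "real^'nu^'nu"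
  assumes Q: "posdef Q" and R: "posdef R" and W: "posdef (Bw ** transpose Bw)"
begin

abbreviation h :: "real^'nx \<Rightarrow> real^'nu \<Rightarrow> real" where "h \<equiv> stage_norm Q R"

abbreviation J :: "real^'nx^'nu \<Rightarrow> real" where "J \<equiv> J_inf A B Bw Q R"

abbreviation x :: "real^'nx^'nu \<Rightarrow> (nat \<Rightarrow> real^'nw) \<Rightarrow> nat \<Rightarrow> real^'nx" where
  "x \<equiv> state A B Bw"

abbreviation cost :: "real^'nx^'nu \<Rightarrow> (nat \<Rightarrow> real^'nw) \<Rightarrow> nat \<Rightarrow> real" where
  "cost K w t \<equiv> h (x K w t) (K *v x K w t)"

lemma form_nonneg: "0 \<le> v \<bullet> (Q *v v)" "0 \<le> u \<bullet> (R *v u)"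
  using Q R posdef_imp_psd unfolding psd_def by blast+

lemma h_nonneg [simp]: "0 \<le> h v u"
  by (simp add: stage_norm_def form_nonneg)

lemma h_triangle: "h (v + v') (u + u') \<le> h v u + h v' u'"
proof -
  have eq: "h v u = sqrt ((sqrt (v \<bullet> (Q *v v)))\<^sup>2 + (sqrt (u \<bullet> (R *v u)))\<^sup>2)" for v u
    by (simp add: stage_norm_def form_nonneg)
  have "h (v + v') (u + u') \<le> sqrt ((sqrt (v \<bullet> (Q *v v)) + sqrt (v' \<bullet> (Q *v v')))\<^sup>2
      + (sqrt (u \<bullet> (R *v u)) + sqrt (u' \<bullet> (R *v u')))\<^sup>2)"
    unfolding eq
    by (intro real_sqrt_le_mono add_mono power_mono psd_sqrt_form_triangle posdef_imp_psd Q R)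
       (simp_all add: form_nonneg)
  also have "\<dots> \<le> h v u + h v' u'"
    unfolding eq by (rule real_sqrt_sum_squares_triangle_ineq)
  finally show ?thesis .
qed

lemma h_scale: "h (c *\<^sub>R v) (c *\<^sub>R u) = \<bar>c\<bar> * h v u"
proof -
  have "(c *\<^sub>R v) \<bullet> (Q *v (c *\<^sub>R v)) + (c *\<^sub>R u) \<bullet> (R *v (c *\<^sub>R u))
      = c\<^sup>2 * (v \<bullet> (Q *v v) + u \<bullet> (R *v u))"
    by (simp add: matrix_vector_mult_scaleR power2_eq_square algebra_simps)
  then show ?thesis by (simp add: stage_norm_def real_sqrt_mult)
qed

lemma h_bounds:
  obtains a b where "a > 0" "b > 0" "\<And>v u. norm v \<le> a * h v u"
    "\<And>v u. h v u \<le> b * (norm v + norm u)"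
proof -
  obtain c where c: "c > 0" "\<And>v. c * (norm v)\<^sup>2 \<le> v \<bullet> (Q *v v)"
    by (rule posdef_lower_bound[OF Q]) (rule that)
  have "norm v \<le> 1 / sqrt c * h v u" for v u
  proof -
    have "sqrt c * norm v = sqrt (c * (norm v)\<^sup>2)" by (simp add: real_sqrt_mult)
    also have "\<dots> \<le> h v u" unfolding stage_norm_def
      using c(2)[of v] form_nonneg(2)[of u] by (intro real_sqrt_le_mono) linarith
    finally show ?thesis using c(1) by (simp add: field_simps)
  qed
  \<comment> \<open>The summand 1 keeps the constant \<open>b\<close> visibly positive.\<close>
  moreover have "h v u \<le> sqrt (1 + norm Q + norm R) * (norm v + norm u)" for v u
  proof -
    have form_le: "w \<bullet> (M *v w) \<le> norm M * (norm w)\<^sup>2" for M :: "real^'k^'k" and w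
    proof -
      have "w \<bullet> (M *v w) \<le> norm w * norm (M *v w)" by (rule norm_cauchy_schwarz)
      also have "\<dots> \<le> norm w * (norm M * norm w)" by (intro mult_left_mono mat_vec_norm_le) simp
      finally show ?thesis by (simp add: power2_eq_square algebra_simps)
    qed
    have "v \<bullet> (Q *v v) + u \<bullet> (R *v u) \<le> norm Q * (norm v)\<^sup>2 + norm R * (norm u)\<^sup>2"
      by (intro add_mono form_le)
    also have "\<dots> \<le> (1 + norm Q + norm R) * (norm v)\<^sup>2 + (1 + norm Q + norm R) * (norm u)\<^sup>2"
      by (intro add_mono mult_right_mono) auto
    also have "\<dots> \<le> (1 + norm Q + norm R) * (norm v + norm u)\<^sup>2"
      by (simp add: power2_sum distrib_left[symmetric] mult_left_mono add_nonneg_nonneg)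
    finally have "h v u \<le> sqrt ((1 + norm Q + norm R) * (norm v + norm u)\<^sup>2)"
      unfolding stage_norm_def by (rule real_sqrt_le_mono)
    then show ?thesis by (simp add: real_sqrt_mult)
  qed
  moreover have "sqrt (1 + norm Q + norm R) > 0"
    by (simp add: add_pos_nonneg)
  ultimately show ?thesis using c(1) by (intro that[of "1 / sqrt c" "sqrt (1 + norm Q + norm R)"]) auto
qed

text \<open>The inverse is \<open>Bw^T (Bw Bw^T)^(-1)\<close>. Through it every additive
  perturbation \<open>d\<close> of the state equation is a disturbance, since
  \<open>d = Bw (E d)\<close>.\<close>

lemma Bw_right_inverse: obtains E where "Bw ** E = mat 1"
proof -
  have "u = 0" if "(Bw ** transpose Bw) *v u = 0" for u
    using W that unfolding posdef_def by (metis inner_zero_right less_irrefl)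
  then obtain F where "F ** (Bw ** transpose Bw) = mat 1"
    using matrix_left_invertible_ker by blast
  then have "(Bw ** transpose Bw) ** F = mat 1" using matrix_left_right_inverse by blast
  then show ?thesis by (intro that[of "transpose Bw ** F"]) (simp add: matrix_mul_assoc)
qed

lemma stage_cost_eq: "v \<bullet> ((Q + transpose K ** R ** K) *v v) = (h v (K *v v))\<^sup>2"
proof -
  have "v \<bullet> ((transpose K ** R ** K) *v v) = (K *v v) \<bullet> (R *v (K *v v))"
    by (metis dot_lmul_matrix inner_commute matrix_vector_mul_assoc transpose_matrix_vector)
  then show ?thesis
    by (simp add: stage_norm_def form_nonneg matrix_vector_mult_add_rdistrib inner_add_right)
qed

lemma l2_unit_ball_L2_set_le:
  assumes "w \<in> l2_unit_ball" shows "L2_set (\<lambda>t. norm (w t)) {..<T} \<le> 1"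
proof -
  have "(\<Sum>t<T. w t \<bullet> w t) \<le> (\<Sum>t. w t \<bullet> w t)"
    using assms by (intro sum_le_suminf) (auto simp: l2_unit_ball_def)
  then have "L2_set (\<lambda>t. norm (w t)) {..<T} \<le> sqrt (\<Sum>t. w t \<bullet> w t)"
    unfolding L2_set_def power2_norm_eq_inner by (rule real_sqrt_le_mono)
  also have "\<dots> \<le> 1" using assms by (simp add: l2_unit_ball_def)
  finally show ?thesis .
qed

text \<open>This makes the series and the supremum in \<open>J_inf\<close> finite. The constant
  depends on \<open>K\<close>; bounds uniform over the sublevel set come later from
  \<open>\<Delta>\<close>.\<close>

lemma cost_finite_gain:
  assumes "K \<in> stabilizing A B"
  obtains c where "c \<ge> 0" "\<And>w T. w \<in> l2_unit_ball \<Longrightarrow> L2_set (cost K w) {..<T} \<le> c"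
proof -
  obtain a b where ab: "a > 0" "b > 0" "\<And>v u. norm v \<le> a * h v u"
    "\<And>v u. h v u \<le> b * (norm v + norm u)"
    by (rule h_bounds) (rule that)
  have "schur_stable (A + B ** K)" using assms by (simp add: stabilizing_def)
  then obtain c where c: "c \<ge> 0" "\<And>y d T. y 0 = 0 \<Longrightarrow> (\<And>t. y (Suc t) = (A + B ** K) *v y t + d t) \<Longrightarrow>
      L2_set (\<lambda>t. norm (y t)) {..<T} \<le> c * L2_set (\<lambda>t. norm (d t)) {..<T}"
    by (rule schur_stable_l2_gain) (rule that, assumption, metis)
  define e where "e = b * (1 + norm K)"
  have e: "e \<ge> 0" using ab by (simp add: e_def)
  have "L2_set (cost K w) {..<T} \<le> e * (c * norm Bw)" if w: "w \<in> l2_unit_ball" for w T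
  proof -
    have "h v (K *v v) \<le> e * norm v" for v
    proof -
      have "h v (K *v v) \<le> b * (norm v + norm K * norm v)"
        using ab mat_vec_norm_le[of K v]
        by (intro order_trans[OF ab(4)] mult_left_mono) auto
      then show ?thesis by (simp add: e_def algebra_simps)
    qed
    then have "L2_set (cost K w) {..<T} \<le> L2_set (\<lambda>t. e * norm (x K w t)) {..<T}"
      by (intro L2_set_mono) auto
    also have "\<dots> = e * L2_set (\<lambda>t. norm (x K w t)) {..<T}"
      using e by (simp add: L2_set_right_distrib)
    also have "\<dots> \<le> e * (c * L2_set (\<lambda>t. norm (Bw *v w t)) {..<T})"
      by (intro mult_left_mono c(2) e) auto
    also have "L2_set (\<lambda>t. norm (Bw *v w t)) {..<T} \<le> L2_set (\<lambda>t. norm Bw * norm (w t)) {..<T}"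
      by (intro L2_set_mono mat_vec_norm_le) auto
    also have "\<dots> = norm Bw * L2_set (\<lambda>t. norm (w t)) {..<T}" by (simp add: L2_set_right_distrib)
    also have "\<dots> \<le> norm Bw" by (simp add: mult_left_le l2_unit_ball_L2_set_le[OF w])
    finally show ?thesis using e c(1) by (simp add: mult_left_mono)
  qed
  then show ?thesis using e c(1) by (intro that[of "e * (c * norm Bw)"]) auto
qed

lemma L2_cost_sq: "(L2_set (cost K w) {..<T})\<^sup>2 = (\<Sum>t<T. (cost K w t)\<^sup>2)"
  by (simp add: L2_set_def sum_nonneg)

lemma summable_cost_sq:
  assumes "\<And>T. L2_set (cost K w) {..<T} \<le> c"
  shows "summable (\<lambda>t. (cost K w t)\<^sup>2)" "(\<Sum>t. (cost K w t)\<^sup>2) \<le> c\<^sup>2"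
proof -
  have le: "(\<Sum>t<T. (cost K w t)\<^sup>2) \<le> c\<^sup>2" for T
    unfolding L2_cost_sq[symmetric] by (intro power_mono assms L2_set_nonneg)
  show s: "summable (\<lambda>t. (cost K w t)\<^sup>2)"
    by (rule summableI_nonneg_bounded[OF _ le]) simp
  show "(\<Sum>t. (cost K w t)\<^sup>2) \<le> c\<^sup>2" by (rule suminf_le_const[OF s le])
qed

lemma J_eq: "J K = sqrt (SUP w \<in> l2_unit_ball. \<Sum>t. (cost K w t)\<^sup>2)"
  by (simp add: J_inf_def stage_cost_eq)

text \<open>Together with \<open>J_le\<close> this characterises \<open>J K\<close> as the least
  upper bound of truncated norms, so that all later estimates concern finite sums.\<close>

lemma L2_cost_le_J:
  assumes "K \<in> stabilizing A B" and w: "w \<in> l2_unit_ball"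
  shows "L2_set (cost K w) {..<T} \<le> J K"
proof -
  obtain c where c: "\<And>w T. w \<in> l2_unit_ball \<Longrightarrow> L2_set (cost K w) {..<T} \<le> c"
    by (rule cost_finite_gain[OF assms(1)]) (rule that)
  note s = summable_cost_sq[OF c]
  have "(\<Sum>t<T. (cost K w t)\<^sup>2) \<le> (\<Sum>t. (cost K w t)\<^sup>2)"
    by (intro sum_le_suminf s w) auto
  also have "\<dots> \<le> (SUP w \<in> l2_unit_ball. \<Sum>t. (cost K w t)\<^sup>2)"
    by (rule cSUP_upper[OF w]) (use s(2) in \<open>auto intro!: bdd_aboveI\<close>)
  finally show ?thesis unfolding J_eq L2_set_def by (rule real_sqrt_le_mono)
qed

lemma J_le:
  assumes "c \<ge> 0" "\<And>w T. w \<in> l2_unit_ball \<Longrightarrow> L2_set (cost K w) {..<T} \<le> c"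
  shows "J K \<le> c"
proof -
  have "(\<lambda>t. 0) \<in> (l2_unit_ball :: (nat \<Rightarrow> real^'nw) set)" by (simp add: l2_unit_ball_def)
  then have "(SUP w \<in> l2_unit_ball. \<Sum>t. (cost K w t)\<^sup>2) \<le> c\<^sup>2"
    by (intro cSUP_least summable_cost_sq assms) auto
  then show ?thesis unfolding J_eq by (rule real_le_lsqrt[OF assms(1)])
qed

subsection \<open>Dependence of trajectories on the gain\<close>

lemma state_eqI:
  assumes "y 0 = 0" "\<And>t. t < T \<Longrightarrow> y (Suc t) = (A + B ** K) *v y t + Bw *v w t" "t \<le> T"
  shows "y t = x K w t"
  using assms(3) by (induction t) (simp_all add: assms)

lemma state_scale: "x K (\<lambda>t. c *\<^sub>R w t) t = c *\<^sub>R x K w t"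
  by (induction t) (simp_all add: matrix_vector_mult_scaleR scaleR_add_right)

text \<open>Homogeneity of the state in \<open>w\<close> and causality extend the bound from the
  unit ball of l2 to arbitrary sequences on a finite horizon.\<close>

lemma cost_L2_gain:
  assumes K: "K \<in> sublevel A B Bw Q R \<Delta>"
  shows "L2_set (cost K w) {..<T} \<le> \<Delta> * L2_set (\<lambda>t. norm (w t)) {..<T}"
proof -
  have Ks: "K \<in> stabilizing A B" and JK: "J K \<le> \<Delta>" using K by (auto simp: sublevel_def)
  have bound: "L2_set (cost K w) {..<T} \<le> \<Delta> * s"
    if s: "s > 0" "L2_set (\<lambda>t. norm (w t)) {..<T} \<le> s" for s
  proof -
    \<comment> \<open>Cutting \<open>w\<close> off at \<open>T\<close> places it in l2 and leaves
      the states before \<open>T\<close> unchanged.\<close>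
    define v where "v t = (if t < T then w t else 0)" for t
    define u where "u t = (1 / s) *\<^sub>R v t" for t
    have sums: "(\<lambda>t. u t \<bullet> u t) sums (\<Sum>t<T. u t \<bullet> u t)"
      by (rule sums_finite) (auto simp: u_def v_def)
    have "(\<Sum>t<T. u t \<bullet> u t) = (L2_set (\<lambda>t. norm (w t)) {..<T} / s)\<^sup>2"
      by (simp add: u_def v_def L2_set_def power_divide sum_nonneg power2_norm_eq_inner[symmetric]
          power2_eq_square sum_divide_distrib)
    also have "\<dots> \<le> 1" using s by (intro power_le_one) (auto simp: divide_le_eq)
    finally have "u \<in> l2_unit_ball"
      using sums by (auto simp: l2_unit_ball_def sums_iff)
    then have "L2_set (cost K u) {..<T} \<le> \<Delta>" using L2_cost_le_J[OF Ks] JK by (meson order_trans)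
    moreover have "x K w t = x K v t" if "t < T" for t
      by (rule state_eqI[of _ T]) (use that in \<open>auto simp: v_def\<close>)
    then have "cost K w t = s * cost K u t" if "t < T" for t
      using that s(1) unfolding u_def state_scale by (simp add: matrix_vector_mult_scaleR h_scale)
    then have "L2_set (cost K w) {..<T} = s * L2_set (cost K u) {..<T}"
      using s(1) by (simp add: L2_set_right_distrib cong: L2_set_cong_simp)
    ultimately show ?thesis using s(1) by (simp add: mult.commute)
  qed
  show ?thesis
  proof (rule field_le_epsilon)
    fix e :: real assume "e > 0"
    have \<Delta>: "0 \<le> \<Delta>"
      by (rule order_trans[OF _ JK], rule order_trans[OF L2_set_nonneg L2_cost_le_J[OF Ks, of "\<lambda>_. 0" 0]])
         (simp add: l2_unit_ball_def)
    \<comment> \<open>Dividing the slack by \<open>\<Delta> + 1\<close> makes it cost at most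
      \<open>e\<close> after multiplication by \<open>\<Delta>\<close>, also when
      \<open>\<Delta>\<close> is 0.\<close>
    define s where "s = L2_set (\<lambda>t. norm (w t)) {..<T} + e / (\<Delta> + 1)"
    have "s > 0" unfolding s_def using \<open>e > 0\<close> \<Delta> by (intro add_nonneg_pos) auto
    then have "L2_set (cost K w) {..<T} \<le> \<Delta> * s"
      by (rule bound) (use \<open>e > 0\<close> \<Delta> in \<open>simp add: s_def\<close>)
    also have "\<dots> = \<Delta> * L2_set (\<lambda>t. norm (w t)) {..<T} + e * (\<Delta> / (\<Delta> + 1))"
      by (simp add: s_def algebra_simps)
    also have "\<dots> \<le> \<Delta> * L2_set (\<lambda>t. norm (w t)) {..<T} + e"
      using \<Delta> \<open>e > 0\<close> by (intro add_left_mono mult_left_le) auto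
    finally show "L2_set (cost K w) {..<T} \<le> \<Delta> * L2_set (\<lambda>t. norm (w t)) {..<T} + e" .
  qed
qed

text \<open>The perturbation \<open>B g\<close> equals \<open>Bw w\<close> with
  \<open>w = E B g\<close>, so the cost bound controls the response with a constant common to all
  gains in the sublevel set. The input is \<open>K y + g\<close> because differences of closed-loop
  inputs have this shape.\<close>

lemma perturbation_gain:
  "\<exists>C\<ge>0. \<forall>K y g T. K \<in> sublevel A B Bw Q R \<Delta> \<longrightarrow> y 0 = 0 \<longrightarrow>
     (\<forall>t. y (Suc t) = (A + B ** K) *v y t + B *v g t) \<longrightarrow>
     L2_set (\<lambda>t. h (y t) (K *v y t + g t)) {..<T} \<le> C * L2_set (\<lambda>t. norm (g t)) {..<T}"
proof -
  obtain E where E: "Bw ** E = mat 1" by (rule Bw_right_inverse)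
  obtain a b where ab: "a > 0" "b > 0" "\<And>v u. norm v \<le> a * h v u"
    "\<And>v u. h v u \<le> b * (norm v + norm u)"
    by (rule h_bounds) (rule that)
  have "L2_set (\<lambda>t. h (y t) (K *v y t + g t)) {..<T}
      \<le> (\<bar>\<Delta>\<bar> * norm (E ** B) + b) * L2_set (\<lambda>t. norm (g t)) {..<T}"
    if K: "K \<in> sublevel A B Bw Q R \<Delta>" and y: "y 0 = 0"
      "\<And>t. y (Suc t) = (A + B ** K) *v y t + B *v g t" for K y g T
  proof -
    let ?w = "\<lambda>t. (E ** B) *v g t"
    have "Bw *v ?w t = B *v g t" for t
      by (simp add: matrix_vector_mul_assoc matrix_mul_assoc E)
    then have yx: "y t = x K ?w t" for t
      by (intro state_eqI[where T = t]) (simp_all add: y)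
    have "h (y t) (K *v y t + g t) \<le> cost K ?w t + b * norm (g t)" for t
      using h_triangle[of "y t" 0 "K *v y t" "g t"] ab(4)[of 0 "g t"] by (simp add: yx)
    then have "L2_set (\<lambda>t. h (y t) (K *v y t + g t)) {..<T}
        \<le> L2_set (\<lambda>t. cost K ?w t + b * norm (g t)) {..<T}" by (intro L2_set_mono) auto
    also have "\<dots> \<le> L2_set (cost K ?w) {..<T} + L2_set (\<lambda>t. b * norm (g t)) {..<T}"
      by (rule L2_set_triangle_ineq)
    also have "L2_set (\<lambda>t. b * norm (g t)) {..<T} = b * L2_set (\<lambda>t. norm (g t)) {..<T}"
      using ab by (simp add: L2_set_right_distrib)
    also have "L2_set (cost K ?w) {..<T} \<le> \<Delta> * L2_set (\<lambda>t. norm (?w t)) {..<T}"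
      by (rule cost_L2_gain[OF K])
    also have "\<dots> \<le> \<bar>\<Delta>\<bar> * L2_set (\<lambda>t. norm (?w t)) {..<T}"
      by (intro mult_right_mono) auto
    also have "\<dots> \<le> \<bar>\<Delta>\<bar> * L2_set (\<lambda>t. norm (E ** B) * norm (g t)) {..<T}"
      by (intro mult_left_mono L2_set_mono mat_vec_norm_le) auto
    also have "\<dots> = \<bar>\<Delta>\<bar> * norm (E ** B) * L2_set (\<lambda>t. norm (g t)) {..<T}"
      by (simp add: L2_set_right_distrib[symmetric] mult.assoc)
    finally show ?thesis by (simp add: algebra_simps)
  qed
  moreover have "0 \<le> \<bar>\<Delta>\<bar> * norm (E ** B) + b" using ab by simp
  ultimately show ?thesis by blast
qed

lemma L2_norm_le_L2_h:
  obtains a where "a > 0"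
    "\<And>f k (S :: nat set). L2_set (\<lambda>t. norm (f t)) S \<le> a * L2_set (\<lambda>t. h (f t) (k t)) S"
proof -
  obtain a b where ab: "a > 0" "b > 0" "\<And>v u. norm v \<le> a * h v u"
    "\<And>v u. h v u \<le> b * (norm v + norm u)"
    by (rule h_bounds) (rule that)
  have "L2_set (\<lambda>t. norm (f t)) S \<le> a * L2_set (\<lambda>t. h (f t) (k t)) S" for f k and S :: "nat set"
  proof -
    have "L2_set (\<lambda>t. norm (f t)) S \<le> L2_set (\<lambda>t. a * h (f t) (k t)) S"
      by (intro L2_set_mono ab) auto
    then show ?thesis using ab by (simp add: L2_set_right_distrib)
  qed
  with ab(1) show ?thesis by (rule that)
qed

lemma trajectory_Lipschitz:
  "\<exists>C\<ge>0. \<forall>K\<in>sublevel A B Bw Q R \<Delta>. \<forall>K'\<in>sublevel A B Bw Q R \<Delta>. \<forall>w\<in>l2_unit_ball. \<forall>T.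
     L2_set (\<lambda>t. h (x K w t - x K' w t) (K *v x K w t - K' *v x K' w t)) {..<T} \<le> C * norm (K - K')"
proof -
  let ?S = "sublevel A B Bw Q R \<Delta>"
  obtain G where G0: "G \<ge> 0" and G1: "\<forall>K y g T. K \<in> ?S \<longrightarrow> y 0 = 0 \<longrightarrow>
     (\<forall>t. y (Suc t) = (A + B ** K) *v y t + B *v g t) \<longrightarrow>
     L2_set (\<lambda>t. h (y t) (K *v y t + g t)) {..<T} \<le> G * L2_set (\<lambda>t. norm (g t)) {..<T}"
    using perturbation_gain[of \<Delta>] by blast
  note G = G0 G1[rule_format]
  obtain a where ab: "a > 0" and
    aL2: "\<And>f k (S :: nat set). L2_set (\<lambda>t. norm (f t)) S \<le> a * L2_set (\<lambda>t. h (f t) (k t)) S"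
    by (rule L2_norm_le_L2_h) (rule that)
  have "L2_set (\<lambda>t. h (x K w t - x K' w t) (K *v x K w t - K' *v x K' w t)) {..<T} \<le> G * (a * \<bar>\<Delta>\<bar>) * norm (K - K')"
    if K: "K \<in> ?S" "K' \<in> ?S" and w: "w \<in> l2_unit_ball" for K K' w T
  proof -
    let ?y = "\<lambda>t. x K w t - x K' w t" and ?g = "\<lambda>t. (K - K') *v x K' w t"
    have "L2_set (cost K' w) {..<T} \<le> \<bar>\<Delta>\<bar>"
      using L2_cost_le_J[OF _ w, of K' T] K(2) by (auto simp: sublevel_def)
    then have n: "L2_set (\<lambda>t. norm (x K' w t)) {..<T} \<le> a * \<bar>\<Delta>\<bar>"
      using ab by (intro order_trans[OF aL2[where k = "\<lambda>t. K' *v x K' w t"]] mult_left_mono) auto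
    \<comment> \<open>The same \<open>?g\<close> that drives the difference of the states accounts
      for the difference of the inputs.\<close>
    have eq: "K *v ?y t + ?g t = K *v x K w t - K' *v x K' w t" for t
      by (simp add: algebra_simps)
    have "L2_set (\<lambda>t. h (?y t) (K *v ?y t + ?g t)) {..<T} \<le> G * L2_set (\<lambda>t. norm (?g t)) {..<T}"
      by (rule G(2)[OF K(1)]) (simp_all add: matrix_vector_mul_assoc[symmetric] algebra_simps)
    also have "\<dots> \<le> G * (norm (K - K') * L2_set (\<lambda>t. norm (x K' w t)) {..<T})"
      by (intro mult_left_mono L2_norm_mat_vec_le G)
    also have "\<dots> \<le> G * (norm (K - K') * (a * \<bar>\<Delta>\<bar>))"
      by (intro mult_left_mono n G) auto
    finally show ?thesis unfolding eq by (simp add: mult_ac)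
  qed
  moreover have "0 \<le> G * (a * \<bar>\<Delta>\<bar>)" using G0 ab by simp
  ultimately show ?thesis by blast
qed

lemma trajectory_cost_weakly_convex:
  "\<exists>C\<ge>0. \<forall>K0\<in>sublevel A B Bw Q R \<Delta>. \<forall>K1\<in>sublevel A B Bw Q R \<Delta>. \<forall>\<theta>.
     (1 - \<theta>) *\<^sub>R K0 + \<theta> *\<^sub>R K1 \<in> sublevel A B Bw Q R \<Delta> \<longrightarrow> 0 \<le> \<theta> \<longrightarrow> \<theta> \<le> 1 \<longrightarrow>
     (\<forall>w\<in>l2_unit_ball. \<forall>T. L2_set (cost ((1 - \<theta>) *\<^sub>R K0 + \<theta> *\<^sub>R K1) w) {..<T}
       \<le> (1 - \<theta>) * L2_set (cost K0 w) {..<T} + \<theta> * L2_set (cost K1 w) {..<T}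
          + C * (\<theta> * (1 - \<theta>) * (norm (K0 - K1))\<^sup>2))"
proof -
  let ?S = "sublevel A B Bw Q R \<Delta>"
  obtain G where G0: "G \<ge> 0" and G1: "\<forall>K y g T. K \<in> ?S \<longrightarrow> y 0 = 0 \<longrightarrow>
     (\<forall>t. y (Suc t) = (A + B ** K) *v y t + B *v g t) \<longrightarrow>
     L2_set (\<lambda>t. h (y t) (K *v y t + g t)) {..<T} \<le> G * L2_set (\<lambda>t. norm (g t)) {..<T}"
    using perturbation_gain[of \<Delta>] by blast
  note G = G0 G1[rule_format]
  obtain a where ab: "a > 0" and
    aL2: "\<And>f k (S :: nat set). L2_set (\<lambda>t. norm (f t)) S \<le> a * L2_set (\<lambda>t. h (f t) (k t)) S"
    by (rule L2_norm_le_L2_h) (rule that)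
  obtain c where c: "c \<ge> 0" and first: "\<forall>K\<in>?S. \<forall>K'\<in>?S. \<forall>w\<in>l2_unit_ball. \<forall>T.
     L2_set (\<lambda>t. h (x K w t - x K' w t) (K *v x K w t - K' *v x K' w t)) {..<T} \<le> c * norm (K - K')"
    using trajectory_Lipschitz[of \<Delta>] by blast
  have "L2_set (cost ((1 - \<theta>) *\<^sub>R K0 + \<theta> *\<^sub>R K1) w) {..<T}
       \<le> (1 - \<theta>) * L2_set (cost K0 w) {..<T} + \<theta> * L2_set (cost K1 w) {..<T}
          + G * (a * c) * (\<theta> * (1 - \<theta>) * (norm (K0 - K1))\<^sup>2)"
    if K: "K0 \<in> ?S" "K1 \<in> ?S" "(1 - \<theta>) *\<^sub>R K0 + \<theta> *\<^sub>R K1 \<in> ?S"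
      and \<theta>: "0 \<le> \<theta>" "\<theta> \<le> 1" and w: "w \<in> l2_unit_ball" for K0 K1 \<theta> w T
  proof -
    define K where "K = (1 - \<theta>) *\<^sub>R K0 + \<theta> *\<^sub>R K1"
    define r where "r = \<theta> * (1 - \<theta>)"
    have r: "r \<ge> 0" using \<theta> by (simp add: r_def)
    let ?y = "\<lambda>t. x K w t - ((1 - \<theta>) *\<^sub>R x K0 w t + \<theta> *\<^sub>R x K1 w t)"
    let ?d = "\<lambda>t. x K0 w t - x K1 w t"
    let ?g = "\<lambda>t. r *\<^sub>R ((K1 - K0) *v ?d t)"
    have Kv: "K *v v = (1 - \<theta>) *\<^sub>R (K0 *v v) + \<theta> *\<^sub>R (K1 *v v)" for v
      by (simp add: K_def matrix_vector_mult_add_rdistrib scaleR_matrix_vector_assoc)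
    have eq: "K *v ?y t + ?g t = K *v x K w t - ((1 - \<theta>) *\<^sub>R (K0 *v x K0 w t) + \<theta> *\<^sub>R (K1 *v x K1 w t))" for t
    proof -
      have "K *v ?y t = K *v x K w t - ((1 - \<theta>) *\<^sub>R (K *v x K0 w t) + \<theta> *\<^sub>R (K *v x K1 w t))"
        by (simp add: matrix_vector_mult_diff_distrib matrix_vector_right_distrib matrix_vector_mult_scaleR)
      \<comment> \<open>Here \<open>K - K0 = \<theta> (K1 - K0)\<close> and
        \<open>K - K1 = - (1 - \<theta>) (K1 - K0)\<close>. The opposite signs leave only the
        difference of the two trajectories.\<close>
      moreover have "(1 - \<theta>) *\<^sub>R (K *v x K0 w t) + \<theta> *\<^sub>R (K *v x K1 w t) - ?g t
          = (1 - \<theta>) *\<^sub>R (K0 *v x K0 w t) + \<theta> *\<^sub>R (K1 *v x K1 w t)"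
        unfolding Kv by (simp add: vec_eq_iff r_def matrix_vector_mult_diff_distrib
            matrix_vector_mult_diff_rdistrib algebra_simps)
      ultimately show ?thesis by (simp add: algebra_simps)
    qed
    have "L2_set (\<lambda>t. h (?y t) (K *v ?y t + ?g t)) {..<T} \<le> G * L2_set (\<lambda>t. norm (?g t)) {..<T}"
    proof (rule G(2))
      show "K \<in> ?S" using K by (simp add: K_def)
      show "?y (Suc t) = (A + B ** K) *v ?y t + B *v ?g t" for t
      proof -
        have "(A + B ** K) *v ?y t + B *v ?g t = A *v ?y t + B *v (K *v ?y t + ?g t)"
          by (simp add: matrix_vector_mult_add_rdistrib matrix_vector_mul_assoc[symmetric]
              matrix_vector_right_distrib)
        also have "\<dots> = ?y (Suc t)"
          unfolding eq by (simp add: vec_eq_iff matrix_vector_mult_diff_distrib matrix_vector_right_distrib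
              matrix_vector_mult_scaleR matrix_vector_mult_add_rdistrib matrix_vector_mul_assoc[symmetric]
              algebra_simps)
        finally show ?thesis by simp
      qed
    qed simp
    also have "\<dots> = G * (r * L2_set (\<lambda>t. norm ((K1 - K0) *v ?d t)) {..<T})"
      using r by (simp add: L2_set_right_distrib)
    also have "\<dots> \<le> G * (r * (norm (K1 - K0) * L2_set (\<lambda>t. norm (?d t)) {..<T}))"
      by (intro mult_left_mono L2_norm_mat_vec_le G r)
    \<comment> \<open>The second factor \<open>norm (K0 - K1)\<close> comes from the Lipschitz bound
      on trajectories, which makes the error quadratic.\<close>
    also have "\<dots> \<le> G * (r * (norm (K1 - K0) * (a * (c * norm (K0 - K1)))))"
      using ab by (intro mult_left_mono G r order_trans[OF aL2 mult_left_mono[OF first[rule_format]]] K w) auto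
    finally have E: "L2_set (\<lambda>t. h (?y t) (K *v ?y t + ?g t)) {..<T} \<le> G * (a * c) * (r * (norm (K0 - K1))\<^sup>2)"
      by (simp add: power2_eq_square norm_minus_commute mult_ac)
    \<comment> \<open>The output of \<open>K\<close> is the deviation plus the convex combination of
      the outputs of \<open>K0\<close> and \<open>K1\<close>.\<close>
    have "cost K w t \<le> h (?y t) (K *v ?y t + ?g t) + ((1 - \<theta>) * cost K0 w t + \<theta> * cost K1 w t)" for t
    proof -
      have "cost K w t \<le> h (?y t) (K *v ?y t + ?g t) + h ((1 - \<theta>) *\<^sub>R x K0 w t + \<theta> *\<^sub>R x K1 w t)
           ((1 - \<theta>) *\<^sub>R (K0 *v x K0 w t) + \<theta> *\<^sub>R (K1 *v x K1 w t))"
        unfolding eq by (rule order_trans[OF _ h_triangle]) simp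
      also have "h ((1 - \<theta>) *\<^sub>R x K0 w t + \<theta> *\<^sub>R x K1 w t)
           ((1 - \<theta>) *\<^sub>R (K0 *v x K0 w t) + \<theta> *\<^sub>R (K1 *v x K1 w t))
         \<le> (1 - \<theta>) * cost K0 w t + \<theta> * cost K1 w t"
        by (rule order_trans[OF h_triangle]) (use \<theta> in \<open>simp add: h_scale\<close>)
      finally show ?thesis by simp
    qed
    then have "L2_set (cost K w) {..<T} \<le> L2_set (\<lambda>t. h (?y t) (K *v ?y t + ?g t)
         + ((1 - \<theta>) * cost K0 w t + \<theta> * cost K1 w t)) {..<T}"
      by (intro L2_set_mono) auto
    also have "\<dots> \<le> L2_set (\<lambda>t. h (?y t) (K *v ?y t + ?g t)) {..<T}
        + (L2_set (\<lambda>t. (1 - \<theta>) * cost K0 w t) {..<T} + L2_set (\<lambda>t. \<theta> * cost K1 w t) {..<T})"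
      by (intro order_trans[OF L2_set_triangle_ineq] add_left_mono L2_set_triangle_ineq)
    also have "\<dots> \<le> G * (a * c) * (r * (norm (K0 - K1))\<^sup>2)
        + ((1 - \<theta>) * L2_set (cost K0 w) {..<T} + \<theta> * L2_set (cost K1 w) {..<T})"
      using \<theta> E by (simp add: L2_set_right_distrib)
    finally show ?thesis by (simp add: K_def r_def)
  qed
  moreover have "0 \<le> G * (a * c)" using G0 ab c by simp
  ultimately show ?thesis by blast
qed

subsection \<open>Lipschitz continuity and weak convexity\<close>

lemma J_nonneg:
  assumes "K \<in> stabilizing A B" shows "0 \<le> J K"
  by (rule order_trans[OF L2_set_nonneg L2_cost_le_J[OF assms, of "\<lambda>_. 0" 0]])
     (simp add: l2_unit_ball_def)

text \<open>The trajectory bound passes to the supremum, once in each order of the two gains. Taking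
  \<open>C + 1\<close> makes the constant strictly positive.\<close>

lemma J_Lipschitz_on_sublevel:
  "\<exists>G>0. \<forall>K \<in> sublevel A B Bw Q R \<Delta>. \<forall>K' \<in> sublevel A B Bw Q R \<Delta>. \<bar>J K - J K'\<bar> \<le> G * norm (K - K')"
proof -
  let ?S = "sublevel A B Bw Q R \<Delta>"
  obtain C where C0: "C \<ge> 0" and C1: "\<forall>K\<in>?S. \<forall>K'\<in>?S. \<forall>w\<in>l2_unit_ball. \<forall>T.
     L2_set (\<lambda>t. h (x K w t - x K' w t) (K *v x K w t - K' *v x K' w t)) {..<T} \<le> C * norm (K - K')"
    using trajectory_Lipschitz[of \<Delta>] by blast
  note C = C0 C1[rule_format]
  have one: "J K \<le> J K' + (C + 1) * norm (K - K')" if K: "K \<in> ?S" "K' \<in> ?S" for K K'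
  proof (rule J_le)
    have st: "K' \<in> stabilizing A B" using K by (simp add: sublevel_def)
    show "0 \<le> J K' + (C + 1) * norm (K - K')" using J_nonneg[OF st] C(1) by simp
    fix w :: "nat \<Rightarrow> real^'nw" and T assume w: "w \<in> l2_unit_ball"
    have "L2_set (cost K w) {..<T} \<le> L2_set (\<lambda>t. cost K' w t
        + h (x K w t - x K' w t) (K *v x K w t - K' *v x K' w t)) {..<T}"
      by (intro L2_set_mono order_trans[OF _ h_triangle]) auto
    also have "\<dots> \<le> L2_set (cost K' w) {..<T}
        + L2_set (\<lambda>t. h (x K w t - x K' w t) (K *v x K w t - K' *v x K' w t)) {..<T}"
      by (rule L2_set_triangle_ineq)
    also have "\<dots> \<le> J K' + C * norm (K - K')"
      by (intro add_mono L2_cost_le_J st w C K)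
    also have "\<dots> \<le> J K' + (C + 1) * norm (K - K')" by (intro add_left_mono mult_right_mono) auto
    finally show "L2_set (cost K w) {..<T} \<le> J K' + (C + 1) * norm (K - K')" .
  qed
  show ?thesis
  proof (intro exI[of _ "C + 1"] conjI ballI)
    fix K K' assume "K \<in> ?S" "K' \<in> ?S"
    then show "\<bar>J K - J K'\<bar> \<le> (C + 1) * norm (K - K')"
      using one[of K K'] one[of K' K] by (simp add: abs_le_iff norm_minus_commute)
  qed (use C in auto)
qed

text \<open>With \<open>\<mu> = 2 * D + 2\<close> the convexity defect of the quadratic term is
  \<open>(D + 1) * ?n\<close>, which covers the error \<open>D * ?n\<close> of the cost.\<close>

lemma J_weakly_convex_on_sublevel:
  "\<exists>\<mu>>0. \<forall>C. convex C \<and> C \<subseteq> sublevel A B Bw Q R \<Delta> \<longrightarrow> convex_on C (\<lambda>K. J K + \<mu> / 2 * (norm K)\<^sup>2)"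
proof -
  let ?S = "sublevel A B Bw Q R \<Delta>"
  obtain D where D0: "D \<ge> 0" and D1: "\<forall>K0\<in>?S. \<forall>K1\<in>?S. \<forall>\<theta>.
     (1 - \<theta>) *\<^sub>R K0 + \<theta> *\<^sub>R K1 \<in> ?S \<longrightarrow> 0 \<le> \<theta> \<longrightarrow> \<theta> \<le> 1 \<longrightarrow>
     (\<forall>w\<in>l2_unit_ball. \<forall>T. L2_set (cost ((1 - \<theta>) *\<^sub>R K0 + \<theta> *\<^sub>R K1) w) {..<T}
       \<le> (1 - \<theta>) * L2_set (cost K0 w) {..<T} + \<theta> * L2_set (cost K1 w) {..<T}
          + D * (\<theta> * (1 - \<theta>) * (norm (K0 - K1))\<^sup>2))"
    using trajectory_cost_weakly_convex[of \<Delta>] by blast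
  note D = D0 D1[rule_format]
  have "convex_on C (\<lambda>K. J K + (2 * D + 2) / 2 * (norm K)\<^sup>2)" if C: "convex C" "C \<subseteq> ?S" for C
  proof (rule convex_onI)
    fix \<theta> :: real and K0 K1 assume \<theta>: "0 < \<theta>" "\<theta> < 1" and K: "K0 \<in> C" "K1 \<in> C"
    let ?K = "(1 - \<theta>) *\<^sub>R K0 + \<theta> *\<^sub>R K1" and ?n = "\<theta> * (1 - \<theta>) * (norm (K0 - K1))\<^sup>2"
    have S: "K0 \<in> ?S" "K1 \<in> ?S" "?K \<in> ?S"
      using C K \<theta> convexD[OF C(1) K, of "1 - \<theta>" \<theta>] by auto
    have n: "?n \<ge> 0" using \<theta> by simp
    have st: "K0 \<in> stabilizing A B" "K1 \<in> stabilizing A B" using S by (auto simp: sublevel_def)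
    have "J ?K \<le> (1 - \<theta>) * J K0 + \<theta> * J K1 + D * ?n"
    proof (rule J_le)
      show "0 \<le> (1 - \<theta>) * J K0 + \<theta> * J K1 + D * ?n"
        using \<theta> D(1) J_nonneg st by (intro add_nonneg_nonneg mult_nonneg_nonneg) auto
      fix w :: "nat \<Rightarrow> real^'nw" and T assume w: "w \<in> l2_unit_ball"
      show "L2_set (cost ?K w) {..<T} \<le> (1 - \<theta>) * J K0 + \<theta> * J K1 + D * ?n"
        by (rule order_trans[OF D(2)])
           (use \<theta> S w st in \<open>auto intro!: add_mono mult_left_mono L2_cost_le_J\<close>)
    qed
    also have "\<dots> \<le> (1 - \<theta>) * J K0 + \<theta> * J K1 + (D + 1) * ?n"
      using n by (intro add_left_mono mult_right_mono) auto
    finally have le: "J ?K \<le> (1 - \<theta>) * J K0 + \<theta> * J K1 + (D + 1) * ?n" .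
    \<comment> \<open>With \<open>?n\<close> for \<open>r\<close>, the last bracket is the squared
      norm of the combination, so both sides of the goal share it and \<open>le\<close>
      remains.\<close>
    have "(1 - \<theta>) * (j + m * p) + \<theta> * (j' + m * q)
        = (1 - \<theta>) * j + \<theta> * j' + m * r + m * ((1 - \<theta>) * p + \<theta> * q - r)"
      for j j' m p q r :: real by (simp add: algebra_simps)
    note split = this[of _ _ _ _ _ ?n]
    have m: "(2 * D + 2) / 2 = D + 1" by simp
    show "J ?K + (2 * D + 2) / 2 * (norm ?K)\<^sup>2
        \<le> (1 - \<theta>) * (J K0 + (2 * D + 2) / 2 * (norm K0)\<^sup>2) + \<theta> * (J K1 + (2 * D + 2) / 2 * (norm K1)\<^sup>2)"
      unfolding norm_convex_combination m split by (rule add_right_mono[OF le])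
  qed (fact C)
  then show ?thesis using D(1) by (intro exI[of _ "2 * D + 2"]) auto
qed

end

subsection \<open>Compactness in the lifted space\<close>

lemma continuous_on_matrix_mult:
  fixes f :: "'a::topological_space \<Rightarrow> real^'k^'m" and g :: "'a \<Rightarrow> real^'n^'k"
  assumes "continuous_on S f" "continuous_on S g"
  shows "continuous_on S (\<lambda>z. f z ** g z)"
  unfolding matrix_matrix_mult_def by (intro continuous_intros assms)

lemma continuous_on_transpose:
  fixes f :: "'a::topological_space \<Rightarrow> real^'n^'m"
  assumes "continuous_on S f"
  shows "continuous_on S (\<lambda>z. transpose (f z))"
  unfolding transpose_def by (intro continuous_intros assms)

lemma continuous_on_hcat:
  fixes f :: "'a::topological_space \<Rightarrow> real^'n^'m" and g :: "'a \<Rightarrow> real^'k^'m"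
  assumes "continuous_on S f" "continuous_on S g"
  shows "continuous_on S (\<lambda>z. f z ||| g z)"
proof -
  have "continuous_on S (\<lambda>z. case j of Inl a \<Rightarrow> f z $ i $ a | Inr b \<Rightarrow> g z $ i $ b)" for i j
    by (cases j) (auto intro!: continuous_intros assms)
  then show ?thesis unfolding hcat_def by (intro continuous_intros)
qed

lemma continuous_on_vcat:
  fixes f :: "'a::topological_space \<Rightarrow> real^'n^'m" and g :: "'a \<Rightarrow> real^'n^'k"
  assumes "continuous_on S f" "continuous_on S g"
  shows "continuous_on S (\<lambda>z. f z /// g z)"
proof -
  have "continuous_on S (\<lambda>z. case i of Inl a \<Rightarrow> f z $ a | Inr b \<Rightarrow> g z $ b)" for i
    by (cases i) (auto intro!: continuous_intros assms)
  then show ?thesis unfolding vcat_def by (intro continuous_intros)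
qed

lemma closed_psd: "closed {M :: real^'n^'n. psd M}"
proof -
  have eq: "{M :: real^'n^'n. psd M} = {M. transpose M = M} \<inter> (\<Inter>v. {M. 0 \<le> v \<bullet> (M *v v)})"
    by (auto simp: psd_def)
  have sym: "closed {M :: real^'n^'n. transpose M = M}"
    by (intro closed_Collect_eq continuous_on_transpose continuous_intros)
  have nonneg: "closed {M :: real^'n^'n. 0 \<le> v \<bullet> (M *v v)}" for v
    unfolding matrix_vector_mult_def by (intro closed_Collect_le continuous_intros)
  show ?thesis unfolding eq by (intro closed_Int closed_INT ballI sym nonneg)
qed

lemma sum_UNIV_sum:
  fixes f :: "'a::finite + 'b::finite \<Rightarrow> real"
  shows "sum f UNIV = (\<Sum>i\<in>UNIV. f (Inl i)) + (\<Sum>i\<in>UNIV. f (Inr i))"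
  using sum.Plus[of "UNIV :: 'a set" "UNIV :: 'b set" f] by (simp add: o_def)

definition stack :: "real^'a \<Rightarrow> real^'b \<Rightarrow> real^('a + 'b)" where
  "stack u v = (\<chi> i. case i of Inl a \<Rightarrow> u $ a | Inr b \<Rightarrow> v $ b)"

lemma block_form:
  "stack u v \<bullet> ((K ||| L /// M ||| N) *v stack u v)
    = u \<bullet> (K *v u) + u \<bullet> (L *v v) + v \<bullet> (M *v u) + v \<bullet> (N *v v)"
  by (simp add: inner_vec_def matrix_vector_mult_def sum_UNIV_sum stack_def hcat_def vcat_def
      distrib_left sum.distrib)

text \<open>Diagonal entries are values of the form at basis vectors; Cauchy-Schwarz for the form
  carries their bound to the other entries.\<close>

lemma psd_entry_le:
  fixes P :: "real^'n^'n"
  assumes P: "psd P" and le: "\<And>v. v \<bullet> (P *v v) \<le> c * (norm v)\<^sup>2"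
  shows "\<bar>P $ i $ j\<bar> \<le> c"
proof -
  have entry: "axis i 1 \<bullet> (P *v axis j 1) = P $ i $ j" for i j
    by (simp add: inner_axis' matrix_vector_mult_basis column_def)
  have nn: "0 \<le> P $ i $ i" for i using P entry[of i i] unfolding psd_def by metis
  have ub: "P $ i $ i \<le> c" for i using le[of "axis i 1"] by (simp add: entry)
  have "\<bar>P $ i $ j\<bar>\<^sup>2 \<le> P $ i $ i * P $ j $ j"
    using psd_Cauchy_Schwarz[OF P, of "axis i 1" "axis j 1"] by (simp add: entry)
  also have "\<dots> \<le> c\<^sup>2" unfolding power2_eq_square
    by (intro mult_mono ub nn order_trans[OF nn ub])
  finally show ?thesis by (rule power2_le_imp_le) (rule order_trans[OF nn ub])
qed

section \<open>Bounds and closed description of the lifted sublevel set\<close>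

context state_feedback
begin

text \<open>Testing the matrix inequality on the stacked vectors \<open>(v, 0)\<close> and
  \<open>(0, u)\<close> isolates the two diagonal blocks.\<close>

lemma M_lft_diagonal_blocks:
  assumes "M_lft A B Bw Q R K \<gamma> P \<preceq>\<^sub>L 0"
  shows "((A + B ** K) *v v) \<bullet> (P *v ((A + B ** K) *v v)) + (h v (K *v v))\<^sup>2 \<le> v \<bullet> (P *v v)"
    and "(Bw *v u) \<bullet> (P *v (Bw *v u)) \<le> \<gamma>\<^sup>2 * (norm u)\<^sup>2"
proof -
  have "stack v u \<bullet> (M_lft A B Bw Q R K \<gamma> P *v stack v u) \<le> 0" for v u
  proof -
    have "0 \<le> stack v u \<bullet> ((0 - M_lft A B Bw Q R K \<gamma> P) *v stack v u)"
      using assms by (simp only: loewner_le_def psd_def)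
    then show ?thesis by (simp only: matrix_vector_mult_diff_rdistrib inner_diff_right) simp
  qed
  note form = this[unfolded M_lft_def block_form]
  have congr: "w \<bullet> ((transpose L ** P ** L) *v w) = (L *v w) \<bullet> (P *v (L *v w))"
    for L :: "real^'k^'nx" and w
    by (metis dot_lmul_matrix inner_commute matrix_vector_mul_assoc transpose_matrix_vector)
  have "v \<bullet> ((transpose (A + B ** K) ** P ** (A + B ** K) - P + Q + transpose K ** R ** K) *v v) \<le> 0"
    using form[of v 0] by simp
  then have "v \<bullet> ((transpose (A + B ** K) ** P ** (A + B ** K)) *v v)
      + v \<bullet> ((Q + transpose K ** R ** K) *v v) \<le> v \<bullet> (P *v v)"
    by (simp add: matrix_vector_mult_add_rdistrib matrix_vector_mult_diff_rdistrib
        inner_add_right inner_diff_right)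
  then show "((A + B ** K) *v v) \<bullet> (P *v ((A + B ** K) *v v)) + (h v (K *v v))\<^sup>2 \<le> v \<bullet> (P *v v)"
    by (simp only: congr stage_cost_eq)
  have "u \<bullet> ((transpose Bw ** P ** Bw - \<gamma>\<^sup>2 *\<^sub>R mat 1) *v u) \<le> 0"
    using form[of 0 u] by simp
  then have "u \<bullet> ((transpose Bw ** P ** Bw) *v u) \<le> \<gamma>\<^sup>2 * (norm u)\<^sup>2"
    by (simp add: matrix_vector_mult_diff_rdistrib inner_diff_right
        scaleR_matrix_vector_assoc[symmetric] power2_norm_eq_inner)
  then show "(Bw *v u) \<bullet> (P *v (Bw *v u)) \<le> \<gamma>\<^sup>2 * (norm u)\<^sup>2" by (simp only: congr)
qed

text \<open>The first bound is the disturbance block at \<open>u = E v\<close>, where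
  \<open>Bw u = v\<close>; the second is the state block with a nonnegative term dropped. The 1 in
  \<open>1 + (norm E)^2\<close> keeps \<open>e\<close> positive, as the quotient
  \<open>q / e\<close> later requires.\<close>

lemma L_lft_bounds:
  obtains e where "e > 0"
    "\<And>K \<gamma> P v. (K, \<gamma>, P) \<in> L_lft A B Bw Q R \<Longrightarrow> v \<bullet> (P *v v) \<le> e * \<gamma>\<^sup>2 * (norm v)\<^sup>2"
    "\<And>K \<gamma> P v. (K, \<gamma>, P) \<in> L_lft A B Bw Q R \<Longrightarrow> (h v (K *v v))\<^sup>2 \<le> v \<bullet> (P *v v)"
proof -
  obtain E where E: "Bw ** E = mat 1" by (rule Bw_right_inverse)
  show ?thesis
  proof (rule that[of "1 + (norm E)\<^sup>2"])
    show "1 + (norm E)\<^sup>2 > 0" by (simp add: add_pos_nonneg)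
  next
    fix K \<gamma> P v assume "(K, \<gamma>, P) \<in> L_lft A B Bw Q R"
    then have P: "posdef P" and M: "M_lft A B Bw Q R K \<gamma> P \<preceq>\<^sub>L 0" by (auto simp: L_lft_def)
    have "v \<bullet> (P *v v) \<le> \<gamma>\<^sup>2 * (norm (E *v v))\<^sup>2"
      using M_lft_diagonal_blocks(2)[OF M, of "E *v v"] by (simp add: matrix_vector_mul_assoc E)
    also have "\<dots> \<le> \<gamma>\<^sup>2 * (norm E * norm v)\<^sup>2"
      by (intro mult_left_mono power_mono mat_vec_norm_le) auto
    also have "\<dots> \<le> (1 + (norm E)\<^sup>2) * \<gamma>\<^sup>2 * (norm v)\<^sup>2"
      by (simp add: power_mult_distrib algebra_simps)
    finally show "v \<bullet> (P *v v) \<le> (1 + (norm E)\<^sup>2) * \<gamma>\<^sup>2 * (norm v)\<^sup>2" .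
    have "0 \<le> ((A + B ** K) *v v) \<bullet> (P *v ((A + B ** K) *v v))"
      using posdef_imp_psd[OF P] by (simp add: psd_def)
    with M_lft_diagonal_blocks(1)[OF M, of v] show "(h v (K *v v))\<^sup>2 \<le> v \<bullet> (P *v v)" by linarith
  qed
qed

lemma h_sq_ge: "v \<bullet> (Q *v v) \<le> (h v u)\<^sup>2" "u \<bullet> (R *v u) \<le> (h v u)\<^sup>2"
  by (simp_all add: stage_norm_def form_nonneg)

text \<open>The strict constraints \<open>\<gamma> > 0\<close> and \<open>P\<close> positive definite may be replaced by closed ones,
  since membership forces \<open>Q \<preceq>\<^sub>L P\<close> and a positive lower bound on \<open>\<gamma>\<close>.\<close>

lemma L_lft_sublevel_closed_form:
  obtains \<gamma>0 where "\<gamma>0 > 0" "\<And>\<Delta>. {(K, \<gamma>, P). (K, \<gamma>, P) \<in> L_lft A B Bw Q R \<and> \<gamma> \<le> \<Delta>}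
    = {(K, \<gamma>, P). \<gamma>0 \<le> \<gamma> \<and> \<gamma> \<le> \<Delta> \<and> psd (P - Q) \<and> psd (0 - M_lft A B Bw Q R K \<gamma> P)}"
proof -
  obtain e where e: "e > 0"
    "\<And>K \<gamma> P v. (K, \<gamma>, P) \<in> L_lft A B Bw Q R \<Longrightarrow> v \<bullet> (P *v v) \<le> e * \<gamma>\<^sup>2 * (norm v)\<^sup>2"
    "\<And>K \<gamma> P v. (K, \<gamma>, P) \<in> L_lft A B Bw Q R \<Longrightarrow> (h v (K *v v))\<^sup>2 \<le> v \<bullet> (P *v v)"
    by (rule L_lft_bounds) (rule that)
  obtain q where q: "q > 0" "\<And>v. q * (norm v)\<^sup>2 \<le> v \<bullet> (Q *v v)"
    by (rule posdef_lower_bound[OF Q]) (rule that)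
  have symQ: "transpose Q = Q" using Q by (simp add: posdef_def)
  have tdiff: "transpose (P - Q) = transpose P - transpose Q" for P
    by (simp add: transpose_def vec_eq_iff)
  have fwd: "sqrt (q / e) \<le> \<gamma> \<and> psd (P - Q)" if mem: "(K, \<gamma>, P) \<in> L_lft A B Bw Q R" for K \<gamma> P
  proof
    have QP: "v \<bullet> (Q *v v) \<le> v \<bullet> (P *v v)" for v
      using h_sq_ge(1) e(3)[OF mem] by (rule order_trans)
    \<comment> \<open>Any unit vector serves: it gives \<open>q \<le> e \<gamma>^2\<close>, hence
      the lower bound on \<open>\<gamma>\<close>.\<close>
    have "q * (norm (axis undefined 1 :: real^'nx))\<^sup>2 \<le> e * \<gamma>\<^sup>2 * (norm (axis undefined 1 :: real^'nx))\<^sup>2"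
      by (rule order_trans[OF order_trans[OF q(2) QP] e(2)[OF mem]])
    then have "q / e \<le> \<gamma>\<^sup>2" using e(1) by (simp add: divide_le_eq mult.commute)
    moreover have "\<gamma> > 0" using mem by (simp add: L_lft_def)
    ultimately show "sqrt (q / e) \<le> \<gamma>" by (intro real_le_lsqrt) auto
    have "transpose P = P" using mem by (simp add: L_lft_def posdef_def)
    then show "psd (P - Q)"
      using QP by (simp add: psd_def tdiff symQ matrix_vector_mult_diff_rdistrib inner_diff_right)
  qed
  have bwd: "posdef P" if PQ: "psd (P - Q)" for P
    unfolding posdef_def
  proof (intro conjI allI impI)
    have "transpose P - transpose Q = P - Q" using PQ by (simp add: psd_def tdiff)
    then show "transpose P = P" by (simp add: symQ)
    fix v :: "real^'nx" assume "v \<noteq> 0"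
    then have "0 < v \<bullet> (Q *v v)" using Q by (simp add: posdef_def)
    also have "\<dots> \<le> v \<bullet> (P *v v)"
      using PQ by (simp add: psd_def matrix_vector_mult_diff_rdistrib inner_diff_right)
    finally show "0 < v \<bullet> (P *v v)" .
  qed
  have g0: "sqrt (q / e) > 0" using q e by simp
  show ?thesis
  proof (rule that[OF g0], intro set_eqI iffI)
    fix \<Delta> z assume "z \<in> {(K, \<gamma>, P). (K, \<gamma>, P) \<in> L_lft A B Bw Q R \<and> \<gamma> \<le> \<Delta>}"
    then obtain K \<gamma> P where z: "z = (K, \<gamma>, P)" "(K, \<gamma>, P) \<in> L_lft A B Bw Q R" "\<gamma> \<le> \<Delta>" by blast
    with fwd[OF z(2)]
    show "z \<in> {(K, \<gamma>, P). sqrt (q / e) \<le> \<gamma> \<and> \<gamma> \<le> \<Delta> \<and> psd (P - Q) \<and> psd (0 - M_lft A B Bw Q R K \<gamma> P)}"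
      by (simp add: L_lft_def loewner_le_def)
  next
    fix \<Delta> z assume "z \<in> {(K, \<gamma>, P). sqrt (q / e) \<le> \<gamma> \<and> \<gamma> \<le> \<Delta> \<and> psd (P - Q) \<and> psd (0 - M_lft A B Bw Q R K \<gamma> P)}"
    then obtain K \<gamma> P where z: "z = (K, \<gamma>, P)" "sqrt (q / e) \<le> \<gamma>" "\<gamma> \<le> \<Delta>" "psd (P - Q)"
      "psd (0 - M_lft A B Bw Q R K \<gamma> P)" by blast
    from less_le_trans[OF g0 z(2)] z bwd[OF z(4)] show "z \<in> {(K, \<gamma>, P). (K, \<gamma>, P) \<in> L_lft A B Bw Q R \<and> \<gamma> \<le> \<Delta>}"
      by (simp add: L_lft_def loewner_le_def)
  qed
qed

lemma bounded_L_lft_sublevel: "bounded {(K, \<gamma>, P). (K, \<gamma>, P) \<in> L_lft A B Bw Q R \<and> \<gamma> \<le> \<Delta>}"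
proof -
  obtain e where e: "e > 0"
    "\<And>K \<gamma> P v. (K, \<gamma>, P) \<in> L_lft A B Bw Q R \<Longrightarrow> v \<bullet> (P *v v) \<le> e * \<gamma>\<^sup>2 * (norm v)\<^sup>2"
    "\<And>K \<gamma> P v. (K, \<gamma>, P) \<in> L_lft A B Bw Q R \<Longrightarrow> (h v (K *v v))\<^sup>2 \<le> v \<bullet> (P *v v)"
    by (rule L_lft_bounds) (rule that)
  obtain r where r: "r > 0" "\<And>u. r * (norm u)\<^sup>2 \<le> u \<bullet> (R *v u)"
    by (rule posdef_lower_bound[OF R]) (rule that)
  define p where "p = e * \<Delta>\<^sup>2"
  define kb where "kb = CARD('nu) * (CARD('nx) * sqrt (p / r))"
  define pb where "pb = CARD('nx) * (CARD('nx) * p)"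
  have "norm K \<le> kb \<and> norm \<gamma> \<le> \<Delta> \<and> norm P \<le> pb"
    if mem: "(K, \<gamma>, P) \<in> L_lft A B Bw Q R" and \<gamma>: "\<gamma> \<le> \<Delta>" for K \<gamma> P
  proof (intro conjI)
    have \<gamma>0: "\<gamma> > 0" and P: "posdef P" using mem by (auto simp: L_lft_def)
    then show "norm \<gamma> \<le> \<Delta>" using \<gamma> by simp
    have Pv: "v \<bullet> (P *v v) \<le> p * (norm v)\<^sup>2" for v
    proof -
      have "e * \<gamma>\<^sup>2 * (norm v)\<^sup>2 \<le> e * \<Delta>\<^sup>2 * (norm v)\<^sup>2"
        using e(1) \<gamma> \<gamma>0 by (intro mult_right_mono mult_left_mono power_mono) auto
      with e(2)[OF mem, of v] show ?thesis by (simp add: p_def)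
    qed
    show "norm P \<le> pb" unfolding pb_def
      by (intro mat_norm_le_entries psd_entry_le posdef_imp_psd P Pv)
    \<comment> \<open>The entry is a component of \<open>K\<close> applied to a basis vector, whose
      size is bounded through \<open>R\<close>, the stage cost and finally \<open>P\<close>.\<close>
    have "\<bar>K $ i $ j\<bar> \<le> sqrt (p / r)" for i j
    proof (rule real_le_rsqrt)
      let ?v = "axis j 1 :: real^'nx"
      have "(K *v ?v) $ i = K $ i $ j" by (simp add: matrix_vector_mult_basis column_def)
      then have "\<bar>K $ i $ j\<bar>\<^sup>2 \<le> (norm (K *v ?v))\<^sup>2"
        by (metis abs_ge_zero component_le_norm_cart power_mono)
      then have "r * \<bar>K $ i $ j\<bar>\<^sup>2 \<le> r * (norm (K *v ?v))\<^sup>2" using r(1) by simp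
      also have "\<dots> \<le> (h ?v (K *v ?v))\<^sup>2" using r(2) h_sq_ge(2) by (rule order_trans)
      also have "\<dots> \<le> p * (norm ?v)\<^sup>2" using e(3)[OF mem] Pv by (rule order_trans)
      finally show "\<bar>K $ i $ j\<bar>\<^sup>2 \<le> p / r" using r(1) by (simp add: pos_le_divide_eq mult.commute)
    qed
    then show "norm K \<le> kb" unfolding kb_def by (rule mat_norm_le_entries)
  qed
  then have "{(K, \<gamma>, P). (K, \<gamma>, P) \<in> L_lft A B Bw Q R \<and> \<gamma> \<le> \<Delta>} \<subseteq> cball 0 kb \<times> cball 0 \<Delta> \<times> cball 0 pb"
    by auto
  then show ?thesis by (rule bounded_subset[rotated]) (intro bounded_Times bounded_cball)
qed

lemma compact_L_lft_sublevel: "compact {(K, \<gamma>, P). (K, \<gamma>, P) \<in> L_lft A B Bw Q R \<and> \<gamma> \<le> \<Delta>}"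
proof -
  obtain \<gamma>0 where \<gamma>0: "{(K, \<gamma>, P). (K, \<gamma>, P) \<in> L_lft A B Bw Q R \<and> \<gamma> \<le> \<Delta>}
    = {(K, \<gamma>, P). \<gamma>0 \<le> \<gamma> \<and> \<gamma> \<le> \<Delta> \<and> psd (P - Q) \<and> psd (0 - M_lft A B Bw Q R K \<gamma> P)}"
    by (rule L_lft_sublevel_closed_form) (rule that)
  let ?M = "\<lambda>z. M_lft A B Bw Q R (fst z) (fst (snd z)) (snd (snd z))"
  \<comment> \<open>Each constraint becomes a closed inequality or the preimage of the closed
    semidefinite cone under a continuous map.\<close>
  have eq: "{(K, \<gamma>, P). \<gamma>0 \<le> \<gamma> \<and> \<gamma> \<le> \<Delta> \<and> psd (P - Q) \<and> psd (0 - M_lft A B Bw Q R K \<gamma> P)}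
    = {z. \<gamma>0 \<le> fst (snd z)} \<inter> {z. fst (snd z) \<le> \<Delta>}
      \<inter> (\<lambda>z. snd (snd z) - Q) -` {N. psd N} \<inter> (\<lambda>z. 0 - ?M z) -` {N. psd N}"
    by auto
  have "continuous_on UNIV ?M"
    unfolding M_lft_def
    by (intro continuous_on_vcat continuous_on_hcat continuous_on_matrix_mult continuous_on_transpose
        continuous_intros)
  then have "closed {(K, \<gamma>, P). \<gamma>0 \<le> \<gamma> \<and> \<gamma> \<le> \<Delta> \<and> psd (P - Q) \<and> psd (0 - M_lft A B Bw Q R K \<gamma> P)}"
    unfolding eq
    by (intro closed_Int closed_Collect_le closed_vimage closed_psd continuous_intros)
  with bounded_L_lft_sublevel show ?thesis unfolding \<gamma>0[symmetric] compact_eq_bounded_closed by blast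
qed

end

theorem proposition3:
  fixes A :: "real^'nx^'nx" and B :: "real^'nu^'nx" and Bw :: "real^'nw^'nx"
    and Q :: "real^'nx^'nx" and R :: "real^'nu^'nu" and \<Delta> :: real
  assumes "controllable A B"
    and "posdef Q" and "posdef R" and "posdef (Bw ** transpose Bw)"
    and "\<Delta> > 0"
  shows "compact {(K, \<gamma>, P). (K, \<gamma>, P) \<in> L_lft A B Bw Q R \<and> \<gamma> \<le> \<Delta>}
    \<and> (\<exists>G>0. \<forall>K \<in> sublevel A B Bw Q R \<Delta>. \<forall>K' \<in> sublevel A B Bw Q R \<Delta>.
          \<bar>J_inf A B Bw Q R K - J_inf A B Bw Q R K'\<bar> \<le> G * norm (K - K'))
    \<and> (\<exists>\<mu>>0. \<forall>C. convex C \<and> C \<subseteq> sublevel A B Bw Q R \<Delta> \<longrightarrow>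
          convex_on C (\<lambda>K. J_inf A B Bw Q R K + \<mu> / 2 * (norm K)\<^sup>2))"
proof -
  interpret state_feedback A B Bw Q R by unfold_locales (fact assms)+
  show ?thesis
    using compact_L_lft_sublevel J_Lipschitz_on_sublevel J_weakly_convex_on_sublevel by blast
qed

end
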